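(* Let $h\in\mathbb{R}[x_1,\dots,x_m]$ be a hyperbolic polynomial with respect to a direction $e\in\mathbb{R}^m$. Let $\xi_1,\dots,\xi_n$ be $n$ independent real random variables with finite supports, with $\mathbb{E}[\xi_i]=\mu_i$ and $\mathrm{Var}[\xi_i]=\tau_i^2$ for $i\in[n]$. Let $v_1,\dots,v_n\in\Gamma_+^h$ be vectors with $\mathrm{rank}_h(v_i)\le 1$ for all $i\in[n]$, and let $\sigma\ge 0$ be defined by $$\sigma^2 := \Big\|\sum_{i=1}^n \tau_i^2\,\mathrm{tr}_h[v_i]\,v_i\Big\|_h .$$ Then $$\Pr_{\xi_1,\dots,\xi_n}\left[\Big\|\sum_{i=1}^n(\xi_i-\mu_i)v_i\Big\|_h\le 4\sigma\right]>0 .$$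
   Context: $[n]=\{1,\dots,n\}$. A homogeneous polynomial $h\in\mathbb{R}[x_1,\dots,x_m]$ of degree $d$ is hyperbolic with respect to $e\in\mathbb{R}^m$ if $h(e)>0$ and for every $x\in\mathbb{R}^m$ the univariate polynomial $t\mapsto h(te-x)$ has only real roots. These $d$ roots, counted with multiplicity, are denoted $\lambda_1(x)\ge\cdots\ge\lambda_d(x)$ and called the hyperbolic eigenvalues of $x$ (with respect to $h$ and $e$). The closed hyperbolicity cone is $\Gamma_+^h=\{x\in\mathbb{R}^m:\lambda_d(x)\ge 0\}$. The hyperbolic trace, rank and norm are $\mathrm{tr}_h[x]=\sum_{i=1}^d\lambda_i(x)$, $\mathrm{rank}_h(x)=|\{i\in[d]:\lambda_i(x)\ne 0\}|$, and $\|x\|_h=\max_{i\in[d]}|\lambda_i(x)|$, all taken with respect to $e$. *)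

theory Defs
  imports
    "HOL-Probability.Probability"
    "HOL-Library.Poly_Mapping"
    "HOL-Computational_Algebra.Fundamental_Theorem_Algebra"
begin

text \<open>
  A polynomial in the variables indexed by the finite type \<open>'m\<close> is a finitely supported map
  from exponent vectors \<open>'m \<Rightarrow>\<^sub>0 nat\<close> to coefficients.
\<close>

type_synonym 'm mpoly = "('m \<Rightarrow>\<^sub>0 nat) \<Rightarrow>\<^sub>0 real"

definition homogeneous_mpoly :: "nat \<Rightarrow> 'm::finite mpoly \<Rightarrow> bool" where
  "homogeneous_mpoly d h \<longleftrightarrow>
     (\<forall>\<alpha>\<in>Poly_Mapping.keys h. (\<Sum>i\<in>UNIV. Poly_Mapping.lookup \<alpha> i) = d)"

definition mpoly_eval :: "'m::finite mpoly \<Rightarrow> real ^ 'm \<Rightarrow> real" where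
  "mpoly_eval h x =
     (\<Sum>\<alpha>\<in>Poly_Mapping.keys h.
        Poly_Mapping.lookup h \<alpha> * (\<Prod>i\<in>UNIV. (x $ i) ^ Poly_Mapping.lookup \<alpha> i))"

text \<open>
  The univariate polynomial \<open>t \<mapsto> h (t e - x)\<close>, obtained by substituting \<open>e\<^sub>i t - x\<^sub>i\<close> for the
  \<open>i\<close>-th variable.
\<close>

definition hyp_charpoly :: "'m::finite mpoly \<Rightarrow> real ^ 'm \<Rightarrow> real ^ 'm \<Rightarrow> real poly" where
  "hyp_charpoly h e x =
     (\<Sum>\<alpha>\<in>Poly_Mapping.keys h.
        smult (Poly_Mapping.lookup h \<alpha>)
          (\<Prod>i\<in>UNIV. [:- (x $ i), e $ i:] ^ Poly_Mapping.lookup \<alpha> i))"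

lemma poly_hyp_charpoly: "poly (hyp_charpoly h e x) t = mpoly_eval h (t *\<^sub>R e - x)"
  by (simp add: hyp_charpoly_def mpoly_eval_def poly_sum poly_prod algebra_simps)

definition real_rooted :: "real poly \<Rightarrow> bool" where
  "real_rooted p \<longleftrightarrow> (\<forall>z::complex. poly (map_poly complex_of_real p) z = 0 \<longrightarrow> z \<in> \<real>)"

definition hyperbolic :: "nat \<Rightarrow> 'm::finite mpoly \<Rightarrow> real ^ 'm \<Rightarrow> bool" where
  "hyperbolic d h e \<longleftrightarrow>
     homogeneous_mpoly d h \<and> mpoly_eval h e > 0 \<and> (\<forall>x. real_rooted (hyp_charpoly h e x))"

text \<open>
  The eigenvalues with multiplicity, in descending order; \<open>hyp_eig h e x i\<close> is
  \<open>\<lambda>\<^sub>i(x)\<close> and is meaningful for \<open>1 \<le> i \<le> d\<close>.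
\<close>

definition hyp_eigs :: "'m::finite mpoly \<Rightarrow> real ^ 'm \<Rightarrow> real ^ 'm \<Rightarrow> real list" where
  "hyp_eigs h e x = rev (sorted_list_of_multiset (proots (hyp_charpoly h e x)))"

definition hyp_eig :: "'m::finite mpoly \<Rightarrow> real ^ 'm \<Rightarrow> real ^ 'm \<Rightarrow> nat \<Rightarrow> real" where
  "hyp_eig h e x i = hyp_eigs h e x ! (i - 1)"

definition hyp_cone :: "nat \<Rightarrow> 'm::finite mpoly \<Rightarrow> real ^ 'm \<Rightarrow> (real ^ 'm) set" where
  "hyp_cone d h e = {x. hyp_eig h e x d \<ge> 0}"

definition hyp_trace :: "nat \<Rightarrow> 'm::finite mpoly \<Rightarrow> real ^ 'm \<Rightarrow> real ^ 'm \<Rightarrow> real" where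
  "hyp_trace d h e x = (\<Sum>i = 1..d. hyp_eig h e x i)"

definition hyp_rank :: "nat \<Rightarrow> 'm::finite mpoly \<Rightarrow> real ^ 'm \<Rightarrow> real ^ 'm \<Rightarrow> nat" where
  "hyp_rank d h e x = card {i \<in> {1..d}. hyp_eig h e x i \<noteq> 0}"

text \<open>For \<open>d = 0\<close>, where there are no eigenvalues, the empty maximum is read as \<open>0\<close>.\<close>

definition hyp_norm :: "nat \<Rightarrow> 'm::finite mpoly \<Rightarrow> real ^ 'm \<Rightarrow> real ^ 'm \<Rightarrow> real" where
  "hyp_norm d h e x = (if d = 0 then 0 else Max ((\<lambda>i. \<bar>hyp_eig h e x i\<bar>) ` {1..d}))"

definition (in prob_space) finitely_supported :: "('a \<Rightarrow> real) \<Rightarrow> bool" where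
  "finitely_supported X \<longleftrightarrow> (\<exists>S. finite S \<and> (AE \<omega> in M. X \<omega> \<in> S))"


text \<open>There are exactly \<open>d\<close> eigenvalues, and they are the roots of \<open>t \<mapsto> h (t e - x)\<close>.\<close>

lemma coeff_mult_top:
  fixes p q :: "real poly"
  assumes "degree p \<le> m" "degree q \<le> n"
  shows "coeff (p * q) (m + n) = coeff p m * coeff q n"
proof (cases "degree p = m \<and> degree q = n")
  case True
  then show ?thesis by (metis coeff_mult_degree_sum)
next
  case False
  then have "degree p < m \<or> degree q < n" using assms by auto
  moreover have "degree (p * q) < m + n"
    using degree_mult_le[of p q] assms calculation by linarith
  ultimately show ?thesis by (auto simp: coeff_eq_0)
qed

lemma degree_coeff_power:
  fixes p :: "real poly"
  assumes "degree p \<le> 1"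
  shows "degree (p ^ k) \<le> k \<and> coeff (p ^ k) k = coeff p 1 ^ k"
proof (induction k)
  case (Suc k)
  then show ?case
    using assms coeff_mult_top[of p 1 "p ^ k" k] degree_mult_le[of p "p ^ k"] by auto
qed simp

lemma degree_coeff_prod:
  fixes p :: "'i \<Rightarrow> real poly"
  assumes "finite A" "\<And>i. degree (p i) \<le> k i"
  shows "degree (\<Prod>i\<in>A. p i) \<le> (\<Sum>i\<in>A. k i) \<and>
         coeff (\<Prod>i\<in>A. p i) (\<Sum>i\<in>A. k i) = (\<Prod>i\<in>A. coeff (p i) (k i))"
  using assms(1)
proof (induction A rule: finite_induct)
  case (insert a A)
  then show ?case
    using assms(2)[of a] coeff_mult_top[of "p a" "k a" "prod p A" "sum k A"]
      degree_mult_le[of "p a" "prod p A"] by auto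
qed simp

lemma hyp_charpoly_top:
  assumes "homogeneous_mpoly d h"
  shows "degree (hyp_charpoly h e x) \<le> d" "coeff (hyp_charpoly h e x) d = mpoly_eval h e"
proof -
  let ?q = "\<lambda>\<alpha>. \<Prod>i\<in>UNIV. [:- (x $ i), e $ i:] ^ Poly_Mapping.lookup \<alpha> i"
  have *: "degree (?q \<alpha>) \<le> d \<and>
      coeff (?q \<alpha>) d = (\<Prod>i\<in>UNIV. (e $ i) ^ Poly_Mapping.lookup \<alpha> i)"
    if "\<alpha> \<in> Poly_Mapping.keys h" for \<alpha>
  proof -
    have 1: "degree [:- (x $ i), e $ i:] \<le> 1" for i
      by simp
    note pw = degree_coeff_power[OF 1]
    have d: "(\<Sum>i\<in>UNIV. Poly_Mapping.lookup \<alpha> i) = d"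
      using that assms by (simp add: homogeneous_mpoly_def)
    have dg: "degree ([:- (x $ i), e $ i:] ^ Poly_Mapping.lookup \<alpha> i) \<le> Poly_Mapping.lookup \<alpha> i" for i
      using pw by blast
    show ?thesis
      using degree_coeff_prod[of UNIV "\<lambda>i. [:- (x $ i), e $ i:] ^ Poly_Mapping.lookup \<alpha> i"
          "\<lambda>i. Poly_Mapping.lookup \<alpha> i", OF _ dg] pw
      unfolding d by simp
  qed
  show "degree (hyp_charpoly h e x) \<le> d"
    unfolding hyp_charpoly_def using *
    by (intro degree_sum_le) (auto intro: order.trans[OF degree_smult_le])
  show "coeff (hyp_charpoly h e x) d = mpoly_eval h e"
    unfolding hyp_charpoly_def mpoly_eval_def using * by (simp add: coeff_sum)
qed

lemma map_of_real_mult: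
  "map_poly complex_of_real (p * q) = map_poly complex_of_real p * map_poly complex_of_real q"
  by (rule poly_eqI) (simp add: coeff_mult coeff_map_poly)

lemma poly_map_of_real:
  "poly (map_poly complex_of_real p) (complex_of_real x) = complex_of_real (poly p x)"
  by (induction p) (simp_all add: map_poly_pCons)

lemma size_proots_real_rooted:
  assumes "p \<noteq> 0" "real_rooted p"
  shows "size (proots p) = degree p"
  using assms
proof (induction "degree p" arbitrary: p)
  case 0
  then obtain c where "p = [:c:]" by (metis degree_eq_zeroE)
  then show ?case by simp
next
  case (Suc n)
  let ?P = "map_poly complex_of_real p"
  have "degree ?P = Suc n" using Suc.hyps(2) by (simp add: degree_map_poly)
  then have "\<not> constant (poly ?P)" by (simp add: constant_degree)
  then obtain z where z: "poly ?P z = 0" using fundamental_theorem_of_algebra by blast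
  then have "z \<in> \<real>" using Suc.prems by (simp add: real_rooted_def)
  then obtain a where a: "z = complex_of_real a" by (elim Reals_cases)
  with z have "poly p a = 0" by (simp add: poly_map_of_real)
  then obtain q where q: "p = [:- a, 1:] * q" by (auto simp: poly_eq_0_iff_dvd dvd_def)
  with Suc.prems have q0: "q \<noteq> 0" by auto
  have "map_poly complex_of_real p = map_poly complex_of_real [:- a, 1:] * map_poly complex_of_real q"
    unfolding q by (rule map_of_real_mult)
  then have "real_rooted q" using Suc.prems by (auto simp: real_rooted_def)
  moreover have dq: "degree p = Suc (degree q)"
    unfolding q using q0 by (subst degree_mult_eq) auto
  ultimately have "size (proots q) = degree q" using Suc.hyps q0 by simp
  moreover have "proots p = proots [:- a, 1:] + proots q"
    unfolding q by (rule proots_mult) (use q0 in auto)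
  ultimately show ?case using dq by simp
qed

lemma hyperbolic_eigs:
  assumes "hyperbolic d h e"
  shows "length (hyp_eigs h e x) = d" "mset (hyp_eigs h e x) = proots (hyp_charpoly h e x)"
    "sorted_wrt (\<ge>) (hyp_eigs h e x)"
proof -
  have "coeff (hyp_charpoly h e x) d \<noteq> 0" "degree (hyp_charpoly h e x) \<le> d"
    using assms hyp_charpoly_top[of d h e x] by (auto simp: hyperbolic_def)
  then have "degree (hyp_charpoly h e x) = d" "hyp_charpoly h e x \<noteq> 0"
    using le_degree[of "hyp_charpoly h e x" d] by auto
  then have s: "size (proots (hyp_charpoly h e x)) = d"
    using size_proots_real_rooted assms by (auto simp: hyperbolic_def)
  show m: "mset (hyp_eigs h e x) = proots (hyp_charpoly h e x)"
    by (simp add: hyp_eigs_def)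
  show "length (hyp_eigs h e x) = d"
    using s m by (metis size_mset)
  show "sorted_wrt (\<ge>) (hyp_eigs h e x)"
    by (simp add: hyp_eigs_def sorted_wrt_rev)
qed

end

theory Submission
  imports Defs
begin

text \<open>
  The norm of \<open>Y\<close> is at most \<open>b\<close> iff \<open>h (x e + Y) h (x e - Y)\<close> has no zero \<open>x > b\<close>, so the theorem
  asks for an outcome \<open>s\<close> of the centred variables for which, with \<open>Y = \<Sum>i. s\<^sub>i v\<^sub>i\<close>, this product is
  positive for all \<open>x > 4 \<sigma>\<close>.  The proof follows the method of interlacing polynomials: bound the
  largest root of the expected product, and then find an outcome that does no worse.

  Zero-free tubes.  Garding's theory says that \<open>h\<close> does not vanish at complex points whose imaginary
  part is in the interior of the hyperbolicity cone (\<open>tube_nonzero\<close>); here it comes from a homotopy of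
  the roots of one-variable restrictions (\<open>roots_stay_below\<close>).  It makes the cone convex and \<open>h\<close>
  monotone along it.  If \<open>v\<close> in the cone has rank at most one, then comparing \<open>h (w + u v)\<close> with
  \<open>h (M e + u v)\<close> shows that it grows at most linearly in \<open>u\<close>, so \<open>h\<close> is affine along \<open>v\<close>
  (\<open>rank_one_affine\<close>).

  Expected products.  By affinity \<open>h (Z + s v) h (Z' - s v)\<close> is quadratic in \<open>s\<close>, hence its expectation
  over a centred \<open>s\<close> depends only on the variance and equals the average over the two signs
  \<open>s = \<plusminus> \<tau>\<close>.  Iterated sign averages are the polynomials \<open>mixed\<close> below.  Each averaging step preserves
  the absence of zeros in the tube (\<open>biaffine_diff_nonzero\<close>, \<open>cmixed_nonzero\<close>).  In particular
  every conditional expectation, and every polynomial on the segment from it to the polynomial of one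
  of the outcomes of the next variable, is real-rooted in \<open>x\<close>; this allows the outcomes to be selected one at a time (\<open>rmixed_selection\<close>).

  Barrier.  It remains to see that the full sign average is positive at \<open>x > 4 \<sigma>\<close>.  Put
  \<open>u\<^sub>i = \<bar>\<tau>\<^sub>i\<bar> v\<^sub>i\<close>, start at \<open>x e - \<Sum>i. \<delta>\<^sub>i u\<^sub>i\<close> and undo the shifts one by one while
  averaging over the corresponding sign.  Positivity and the bound \<open>D\<^bsub>u\<^sub>i\<^esub> h / h \<le> \<delta>\<^sub>i / 2\<close> on the
  logarithmic derivatives survive each such step (\<open>barrier_step\<close>): the Wronskian of the polynomial and
  of its derivative along another direction is nonnegative on the real line, and for quadratics this
  yields the convexity estimate that is needed (\<open>barrier_inequality\<close>).  Initially, if the starting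
  point is at least \<open>l e\<close> in the cone order, the logarithmic derivative along \<open>u\<^sub>i\<close> is at most
  \<open>tr u\<^sub>i / l\<close>.  With \<open>\<delta>\<^sub>i = c tr u\<^sub>i\<close> the requirement becomes \<open>c l \<ge> 2\<close>, and by the definition of
  \<open>\<sigma>\<close> the total shift is at most \<open>c \<sigma>\<^sup>2 e\<close>; so \<open>x \<ge> c \<sigma>\<^sup>2 + l\<close> suffices, and \<open>c = 4 / x\<close>, \<open>l = x / 2\<close>
  satisfy everything as soon as \<open>x > 4 \<sigma>\<close>.
\<close>

section \<open>Polynomials and the location of their roots\<close>

text \<open>
  No linear factor shrinks from \<open>a\<close> to \<open>b\<close>.
\<close>

lemma norm_poly_mono_of_roots:
  fixes p :: "complex poly"
  assumes "\<And>\<rho>. poly p \<rho> = 0 \<Longrightarrow> cmod (a - \<rho>) \<le> cmod (b - \<rho>)"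
  shows "cmod (poly p a) \<le> cmod (poly p b)"
proof (cases "p = 0")
  case False
  have eval: "cmod (poly p z) = cmod (lead_coeff p) * (\<Prod>\<rho>\<in>#proots p. cmod (z - \<rho>))" for z
  proof -
    have *: "poly (\<Prod>x\<in>#A. [:- x, 1:]) z = (\<Prod>x\<in>#A. z - x)" for A
      by (induction A) (auto simp: algebra_simps)
    have **: "cmod (\<Prod>x\<in>#A. z - x) = (\<Prod>x\<in>#A. cmod (z - x))" for A
      by (induction A) (auto simp: norm_mult)
    have "poly p z = poly (smult (lead_coeff p) (\<Prod>x\<in>#proots p. [:- x, 1:])) z"
      by (simp add: complex_poly_decompose_multiset)
    then show ?thesis by (simp add: * ** norm_mult)
  qed
  have "(\<Prod>\<rho>\<in>#A. cmod (a - \<rho>)) \<le> (\<Prod>\<rho>\<in>#A. cmod (b - \<rho>))"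
    if "set_mset A \<subseteq> {\<rho>. poly p \<rho> = 0}" for A
    using that
  proof (induction A)
    case (add x A)
    have "0 \<le> (\<Prod>\<rho>\<in>#A. cmod (a - \<rho>))"
      by (induction A) auto
    then show ?case using add assms by (auto intro!: mult_mono)
  qed auto
  from this[of "proots p"] show ?thesis
    using False by (simp add: eval mult_left_mono)
qed simp

text \<open>
  Moving up from the real line leads away from all roots in the lower half-plane.  The estimate is what
  keeps the roots from reaching the real line in \<open>roots_stay_below\<close>: it bounds the polynomial on the
  whole upper half-plane from below by its values on the real line.
\<close>

lemma norm_poly_mono_upper:
  fixes p :: "complex poly"
  assumes "\<And>\<rho>. Im \<rho> \<ge> 0 \<Longrightarrow> poly p \<rho> \<noteq> 0" and "Im z \<ge> 0"
  shows "cmod (poly p (of_real (Re z))) \<le> cmod (poly p z)"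
proof (rule norm_poly_mono_of_roots)
  fix \<rho> assume "poly p \<rho> = 0"
  with assms(1) have "Im \<rho> < 0" by (meson not_le)
  then have "\<bar>Im \<rho>\<bar> \<le> \<bar>Im z - Im \<rho>\<bar>" using assms(2) by simp
  then show "cmod (of_real (Re z) - \<rho>) \<le> cmod (z - \<rho>)"
    by (simp add: cmod_def abs_le_square_iff[symmetric])
qed

lemma real_rooted_mono:
  fixes p :: "real poly"
  assumes rr: "real_rooted p" and pos: "\<And>x. x \<ge> a \<Longrightarrow> poly p x > 0" and "a \<le> b"
  shows "poly p a \<le> poly p b"
proof -
  let ?P = "map_poly complex_of_real p"
  have "cmod (poly ?P (of_real a)) \<le> cmod (poly ?P (of_real b))"
  proof (rule norm_poly_mono_of_roots)
    fix \<rho> assume r: "poly ?P \<rho> = 0"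
    with rr obtain t where t: "\<rho> = complex_of_real t"
      by (auto simp: real_rooted_def elim: Reals_cases)
    with r have "poly p t = 0" by (simp add: poly_map_of_real)
    with pos[of t] have "t < a" by force
    then show "cmod (of_real a - \<rho>) \<le> cmod (of_real b - \<rho>)"
      unfolding t of_real_diff[symmetric] norm_of_real using \<open>a \<le> b\<close> by simp
  qed
  then show ?thesis
    using pos[of a] pos[of b] \<open>a \<le> b\<close> by (simp add: poly_map_of_real)
qed

text \<open>
  The root-counting half of the interlacing argument.  Along the segment from \<open>g\<close> to \<open>f\<close> no real root
  can enter \<open>[a, \<infinity>)\<close>: not through \<open>a\<close>, where the values stay positive, and not from the complex plane,
  as all polynomials are real-rooted.  Quantitatively, a real-rooted polynomial that is positive on
  \<open>[a, \<infinity>)\<close> increases there, so it stays above the minimum \<open>m\<close> of \<open>f a\<close> and \<open>g a\<close>; a change of the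
  parameter that moves the values on the bounded part of the ray by less than \<open>m\<close> then preserves
  positivity.
\<close>

lemma real_rooted_segment_pos:
  fixes f g :: "real poly"
  assumes rr: "\<And>t. 0 \<le> t \<Longrightarrow> t \<le> 1 \<Longrightarrow> real_rooted (smult (1 - t) f + smult t g)"
    and lead: "lead_coeff f > 0" "lead_coeff g > 0"
    and g: "\<And>x. x \<ge> a \<Longrightarrow> poly g x > 0" and fa: "poly f a > 0" and b: "a \<le> b"
  shows "poly f b > 0"
proof -
  define F where "F t x = (1 - t) * poly f x + t * poly g x" for t x
  have F_poly: "poly (smult (1 - t) f + smult t g) x = F t x" for t x by (simp add: F_def)
  define m where "m = min (poly f a) (poly g a)"
  have m: "m > 0" using fa g[of a] by (simp add: m_def)
  have Fa: "F t a \<ge> m" if "0 \<le> t" "t \<le> 1" for t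
  proof -
    have "(1 - t) * m + t * m \<le> F t a"
      unfolding F_def m_def using that by (intro add_mono mult_left_mono) auto
    then show ?thesis by (simp add: algebra_simps)
  qed
  obtain X where X: "\<And>x. x \<ge> X \<Longrightarrow> poly f x > 0 \<and> poly g x > 0"
  proof -
    obtain n1 n2 where "\<forall>x\<ge>n1. lead_coeff f \<le> poly f x" "\<forall>x\<ge>n2. lead_coeff g \<le> poly g x"
      using poly_pinfty_gt_lc lead by metis
    then show ?thesis using lead by (intro that[of "max n1 n2"]) (auto intro: less_le_trans)
  qed
  have "bounded ((\<lambda>x. poly g x - poly f x) ` {a..X})"
    by (intro compact_imp_bounded compact_continuous_image continuous_intros) auto
  then obtain K where K: "K > 0" "\<And>x. a \<le> x \<Longrightarrow> x \<le> X \<Longrightarrow> \<bar>poly g x - poly f x\<bar> \<le> K"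
    unfolding bounded_pos by auto
  have step: "\<forall>x\<ge>a. F t' x > 0"
    if t: "0 \<le> t" "t \<le> 1" "0 \<le> t'" "t' \<le> 1" and d: "\<bar>t' - t\<bar> * K < m" and good: "\<forall>x\<ge>a. F t x > 0" for t t'
  proof (intro allI impI)
    fix x assume x: "x \<ge> a"
    show "F t' x > 0"
    proof (cases "x \<le> X")
      case True
      have "m \<le> F t a" using Fa t by simp
      also have "F t a \<le> F t x"
        using real_rooted_mono[OF rr[OF t(1,2)], of a x] good x unfolding F_poly by simp
      finally have "m \<le> F t x" .
      moreover have "F t' x = F t x + (t' - t) * (poly g x - poly f x)"
        by (simp add: F_def algebra_simps)
      moreover have "\<bar>(t' - t) * (poly g x - poly f x)\<bar> \<le> \<bar>t' - t\<bar> * K"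
        unfolding abs_mult using K(2)[OF x True] by (intro mult_left_mono) auto
      ultimately show ?thesis using d by linarith
    next
      case False
      then have fg: "poly f x > 0" "poly g x > 0" using X[of x] by auto
      show ?thesis
      proof (cases "t' = 1")
        case False
        then have "(1 - t') * poly f x > 0" "t' * poly g x \<ge> 0" using t fg by auto
        then show ?thesis unfolding F_def by linarith
      qed (simp add: F_def fg)
    qed
  qed
  obtain N :: nat where N: "N > 0" "1 / real N < m / K"
    using m K(1) by (metis divide_pos_pos nat_approx_posE zero_less_Suc)
  have "\<forall>x\<ge>a. F (1 - real k / real N) x > 0" if "k \<le> N" for k
    using that
  proof (induction k)
    case 0
    then show ?case using g by (simp add: F_def)
  next
    case (Suc k)
    show ?case
    proof (rule step[OF _ _ _ _ _ Suc.IH])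
      have "1 - real (Suc k) / real N - (1 - real k / real N) = - (1 / real N)"
        by (simp add: add_divide_distrib)
      then show "\<bar>1 - real (Suc k) / real N - (1 - real k / real N)\<bar> * K < m"
        using N K(1) by (simp add: field_simps)
    qed (use Suc.prems N in auto)
  qed
  from this[of N] N b show ?thesis by (simp add: F_def)
qed

lemma poly_eq_prod_proots:
  fixes p :: "real poly"
  assumes "p \<noteq> 0" "size (proots p) = degree p"
  shows "poly p t = lead_coeff p * (\<Prod>a\<in>#proots p. t - a)"
  using assms
proof (induction "degree p" arbitrary: p)
  case 0
  then obtain c where "p = [:c:]" by (metis degree_eq_zeroE)
  then show ?case by simp
next
  case (Suc n)
  then have "proots p \<noteq> {#}" by auto
  then obtain a where "a \<in># proots p" by blast
  then have "poly p a = 0" using Suc.prems by simp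
  then obtain q where q: "p = [:- a, 1:] * q" by (auto simp: poly_eq_0_iff_dvd dvd_def)
  with Suc.prems have q0: "q \<noteq> 0" by auto
  have pr: "proots p = add_mset a (proots q)"
    unfolding q by (subst proots_mult) (use q0 in auto)
  have dq: "degree p = Suc (degree q)"
    unfolding q using q0 by (subst degree_mult_eq) auto
  have lc: "lead_coeff p = lead_coeff q" unfolding q lead_coeff_mult by simp
  have "poly q t = lead_coeff q * (\<Prod>a\<in>#proots q. t - a)"
    using Suc.hyps q0 dq pr Suc.prems by simp
  then have "poly p t = (t - a) * (lead_coeff q * (\<Prod>a\<in>#proots q. t - a))"
    unfolding q by (simp add: algebra_simps)
  then show ?case unfolding pr lc by simp
qed

lemma charpoly_eq_prod_eig:
  assumes "hyperbolic d h e"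
  shows "mpoly_eval h (t *\<^sub>R e - x) = mpoly_eval h e * (\<Prod>i = 1..d. t - hyp_eig h e x i)"
proof -
  let ?p = "hyp_charpoly h e x"
  have c: "coeff ?p d \<noteq> 0" "degree ?p \<le> d" "coeff ?p d = mpoly_eval h e"
    using assms hyp_charpoly_top[of d h e x] by (auto simp: hyperbolic_def)
  then have deg: "degree ?p = d" "?p \<noteq> 0" using le_degree[of ?p d] by auto
  have "size (proots ?p) = degree ?p"
    using size_proots_real_rooted deg assms by (auto simp: hyperbolic_def)
  then have "poly ?p t = mpoly_eval h e * (\<Prod>a\<in>#proots ?p. t - a)"
    using poly_eq_prod_proots[of ?p t] deg c by simp
  also have "(\<Prod>a\<in>#proots ?p. t - a) = prod_list (map (\<lambda>a. t - a) (hyp_eigs h e x))"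
    unfolding hyperbolic_eigs(2)[OF assms, symmetric] by (simp flip: prod_mset_prod_list mset_map)
  also have "\<dots> = (\<Prod>i = 0..<d. t - hyp_eigs h e x ! i)"
    by (simp add: prod.list_conv_set_nth hyperbolic_eigs(1)[OF assms])
  also have "\<dots> = (\<Prod>i = 1..d. t - hyp_eig h e x i)"
    unfolding hyp_eig_def
    by (rule prod.reindex_bij_witness[of _ "\<lambda>i. i - 1" "\<lambda>i. i + 1"]) auto
  finally show ?thesis by (simp add: poly_hyp_charpoly)
qed

lemma poly_affine_bound_degree:
  fixes p :: "real poly"
  assumes "\<And>u. u \<ge> 0 \<Longrightarrow> 0 \<le> poly p u" "\<And>u. u \<ge> 0 \<Longrightarrow> poly p u \<le> a + b * u"
  shows "degree p \<le> 1"
proof (rule ccontr)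
  assume "\<not> degree p \<le> 1"
  then have deg: "degree p > 1" by simp
  let ?q = "p - [:a, b:]"
  have "degree [:a, b:] < degree p" using deg by (auto intro: le_less_trans[of _ 1])
  then have q: "lead_coeff ?q = lead_coeff p"
    using deg by (metis add.commute diff_conv_add_uminus degree_minus lead_coeff_add_le)
  consider "lead_coeff ?q > 0" | "lead_coeff (- p) > 0"
    using q deg by (fastforce simp: neq_iff)
  then show False
  proof cases
    case 1
    then obtain n where "\<forall>x\<ge>n. lead_coeff ?q \<le> poly ?q x" using poly_pinfty_gt_lc by blast
    then have "lead_coeff ?q \<le> poly ?q (max n 0)" by simp
    with 1 assms(2)[of "max n 0"] show False by (simp add: algebra_simps)
  next
    case 2
    then obtain n where "\<forall>x\<ge>n. lead_coeff (- p) \<le> poly (- p) x" using poly_pinfty_gt_lc by blast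
    then have "lead_coeff (- p) \<le> poly (- p) (max n 0)" by simp
    with 2 assms(1)[of "max n 0"] show False by simp
  qed
qed

lemma poly_zero_on_ray:
  fixes p :: "real poly"
  assumes "\<And>s. s > s0 \<Longrightarrow> poly p s = 0"
  shows "p = 0"
proof (rule ccontr)
  assume "p \<noteq> 0"
  then have "finite {s. poly p s = 0}" by (rule poly_roots_finite)
  moreover have "{s0<..} \<subseteq> {s. poly p s = 0}" using assms by auto
  ultimately show False using infinite_Ioi finite_subset by blast
qed

lemma poly_zero_on_reals:
  fixes p :: "complex poly"
  assumes "\<And>s :: real. poly p (of_real s) = 0"
  shows "p = 0"
proof (rule ccontr)
  assume "p \<noteq> 0"
  then have "finite {s. poly p s = 0}" by (rule poly_roots_finite)
  moreover have "range complex_of_real \<subseteq> {s. poly p s = 0}" using assms by auto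
  moreover have "infinite (range complex_of_real)"
    by (simp add: finite_image_iff inj_of_real infinite_UNIV_char_0)
  ultimately show False using finite_subset by blast
qed

section \<open>Complex evaluation\<close>

definition cvec :: "real ^ 'm \<Rightarrow> complex ^ 'm" where
  "cvec x = (\<chi> i. complex_of_real (x $ i))"

lemma cvec_simps [simp]:
  "cvec 0 = 0" "cvec (x + y) = cvec x + cvec y" "cvec (x - y) = cvec x - cvec y"
  "cvec (- x) = - cvec x" "cvec (r *\<^sub>R x) = complex_of_real r *s cvec x"
  by (simp_all add: cvec_def vec_eq_iff)

definition mpoly_ceval :: "'m::finite mpoly \<Rightarrow> complex ^ 'm \<Rightarrow> complex" where
  "mpoly_ceval h z =
     (\<Sum>\<alpha>\<in>Poly_Mapping.keys h. complex_of_real (Poly_Mapping.lookup h \<alpha>) *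
        (\<Prod>i\<in>UNIV. (z $ i) ^ Poly_Mapping.lookup \<alpha> i))"

lemma mpoly_ceval_cvec [simp]: "mpoly_ceval h (cvec x) = complex_of_real (mpoly_eval h x)"
  by (simp add: mpoly_ceval_def mpoly_eval_def cvec_def)

lemma mpoly_ceval_scale:
  assumes "homogeneous_mpoly d h"
  shows "mpoly_ceval h (c *s z) = c ^ d * mpoly_ceval h z"
proof -
  have "(\<Prod>i\<in>UNIV. (c * z $ i) ^ Poly_Mapping.lookup \<alpha> i) =
      c ^ d * (\<Prod>i\<in>UNIV. (z $ i) ^ Poly_Mapping.lookup \<alpha> i)"
    if "\<alpha> \<in> Poly_Mapping.keys h" for \<alpha>
    using that assms
    by (auto simp: power_mult_distrib prod.distrib power_sum homogeneous_mpoly_def)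
  then show ?thesis
    unfolding mpoly_ceval_def by (simp add: sum_distrib_left algebra_simps)
qed

lemma mpoly_eval_scale:
  assumes "homogeneous_mpoly d h"
  shows "mpoly_eval h (c *\<^sub>R x) = c ^ d * mpoly_eval h x"
proof -
  have "complex_of_real (mpoly_eval h (c *\<^sub>R x)) = complex_of_real (c ^ d * mpoly_eval h x)"
    using mpoly_ceval_scale[OF assms, of "of_real c" "cvec x"]
    by (simp flip: mpoly_ceval_cvec)
  then show ?thesis by (simp only: of_real_eq_iff)
qed

lemma mpoly_ceval_line:
  obtains p where "\<And>\<zeta>. poly p \<zeta> = mpoly_ceval h (a + \<zeta> *s b)"
proof
  fix \<zeta>
  show "poly (\<Sum>\<alpha>\<in>Poly_Mapping.keys h. smult (complex_of_real (Poly_Mapping.lookup h \<alpha>))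
          (\<Prod>i\<in>UNIV. [:a $ i, b $ i:] ^ Poly_Mapping.lookup \<alpha> i)) \<zeta> = mpoly_ceval h (a + \<zeta> *s b)"
    by (simp add: mpoly_ceval_def poly_sum poly_prod)
qed

lemma continuous_mpoly_ceval [continuous_intros]:
  "continuous_on S f \<Longrightarrow> continuous_on S (\<lambda>x. mpoly_ceval h (f x))"
  unfolding mpoly_ceval_def by (intro continuous_intros)

lemma continuous_vector_smult [continuous_intros]:
  fixes f :: "'a::topological_space \<Rightarrow> complex" and g :: "'a \<Rightarrow> complex ^ 'n"
  shows "continuous_on S f \<Longrightarrow> continuous_on S g \<Longrightarrow> continuous_on S (\<lambda>x. f x *s g x)"
  unfolding vector_scalar_mult_def by (intro continuous_intros)

lemma map_of_real_add:
  "map_poly complex_of_real (p + q) = map_poly complex_of_real p + map_poly complex_of_real q"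
  by (rule poly_eqI) (simp add: coeff_map_poly)

lemma map_of_real_smult:
  "map_poly complex_of_real (smult c p) = smult (of_real c) (map_poly complex_of_real p)"
  by (rule poly_eqI) (simp add: coeff_map_poly)

lemma map_poly_hyp_charpoly:
  "poly (map_poly complex_of_real (hyp_charpoly h e x)) t = mpoly_ceval h (t *s cvec e - cvec x)"
proof -
  have su: "map_poly complex_of_real (sum f A) = (\<Sum>a\<in>A. map_poly complex_of_real (f a))"
    for f :: "'x \<Rightarrow> real poly" and A
    by (induction A rule: infinite_finite_induct) (auto simp: map_of_real_add)
  have pr: "map_poly complex_of_real (prod f A) = (\<Prod>a\<in>A. map_poly complex_of_real (f a))"
    for f :: "'x \<Rightarrow> real poly" and A
    by (induction A rule: infinite_finite_induct) (auto simp: map_of_real_mult)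
  have pw: "map_poly complex_of_real (p ^ k) = map_poly complex_of_real p ^ k" for p k
    by (induction k) (auto simp: map_of_real_mult)
  show ?thesis
    by (simp add: hyp_charpoly_def mpoly_ceval_def su pr pw map_of_real_smult poly_sum poly_prod map_poly_pCons
        cvec_def algebra_simps)
qed

section \<open>The hyperbolicity cone\<close>

text \<open>
  As \<open>r\<close> runs from \<open>0\<close> to \<open>1\<close>, the roots of \<open>z \<mapsto> h (r a + b + z c)\<close> start in the open lower half-plane,
  never meet the real line and never escape to infinity, hence they remain where they are.  Instead of
  following roots, the proof bounds the polynomial: when all its roots are below the real line, its
  modulus on the closed upper half-plane is at least its minimum \<open>m\<close> on the relevant real segment, so
  changing \<open>r\<close> by an amount that moves the values by less than \<open>m\<close> creates no root there.
\<close>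

lemma roots_stay_below:
  fixes a b c :: "complex ^ 'm::finite"
  assumes hom: "homogeneous_mpoly d h" and lead: "mpoly_ceval h c \<noteq> 0"
    and nonreal: "\<And>r t. 0 \<le> r \<Longrightarrow> r \<le> 1 \<Longrightarrow>
      mpoly_ceval h (of_real r *s a + b + complex_of_real t *s c) \<noteq> 0"
    and start: "\<And>z. Im z \<ge> 0 \<Longrightarrow> mpoly_ceval h (b + z *s c) \<noteq> 0"
    and z: "Im z \<ge> 0"
  shows "mpoly_ceval h (a + b + z *s c) \<noteq> 0"
proof -
  define f where "f r z = mpoly_ceval h (of_real r *s a + b + z *s c)" for r :: real and z
  have cont: "continuous_on UNIV (\<lambda>(r, z). f r z)"
    unfolding f_def case_prod_beta by (intro continuous_intros)
  \<comment> \<open>By homogeneity, large roots would give zeros of \<open>h\<close> close to \<open>c\<close>.\<close>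
  obtain L where L: "L > 0" "\<And>r z. 0 \<le> r \<Longrightarrow> r \<le> 1 \<Longrightarrow> cmod z > L \<Longrightarrow> f r z \<noteq> 0"
  proof -
    have "continuous_on UNIV (\<lambda>(r :: real, w). mpoly_ceval h (w *s (of_real r *s a + b) + c))"
      unfolding case_prod_beta by (intro continuous_intros)
    then have cu: "uniformly_continuous_on ({0..1} \<times> cball 0 1)
        (\<lambda>(r :: real, w). mpoly_ceval h (w *s (of_real r *s a + b) + c))"
      by (intro compact_uniformly_continuous compact_Times)
         (auto intro: continuous_on_subset)
    obtain \<epsilon> where \<epsilon>: "\<epsilon> > 0" "\<And>x x'. x \<in> {0..1} \<times> cball 0 1 \<Longrightarrow> x' \<in> {0..1} \<times> cball 0 1 \<Longrightarrow>
        dist x' x < \<epsilon> \<Longrightarrow> dist ((\<lambda>(r :: real, w). mpoly_ceval h (w *s (of_real r *s a + b) + c)) x')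
          ((\<lambda>(r :: real, w). mpoly_ceval h (w *s (of_real r *s a + b) + c)) x) < cmod (mpoly_ceval h c)"
      using uniformly_continuous_onE[OF cu, of "cmod (mpoly_ceval h c)"] lead
      by (metis zero_less_norm_iff)
    define L where "L = 1 + 1 / \<epsilon>"
    have "f r z \<noteq> 0" if "0 \<le> r" "r \<le> 1" "cmod z > L" for r z
    proof
      assume fz: "f r z = 0"
      have L1: "L \<ge> 1" "L > 1 / \<epsilon>" using \<epsilon>(1) by (auto simp: L_def)
      have z0: "z \<noteq> 0" using that L1 by auto
      have "cmod (1 / z) \<le> 1" using that L1 z0 by (simp add: norm_divide divide_le_eq)
      moreover have "cmod (1 / z) < \<epsilon>"
      proof -
        have "1 / \<epsilon> < cmod z" using that L1 by simp
        then show ?thesis using \<epsilon>(1) z0 by (simp add: norm_divide field_simps)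
      qed
      ultimately have "dist (mpoly_ceval h ((1/z) *s (of_real r *s a + b) + c)) (mpoly_ceval h c)
          < cmod (mpoly_ceval h c)"
        using \<epsilon>(2)[of "(r, 0)" "(r, 1 / z)"] that by (auto simp: dist_Pair_Pair)
      moreover have "mpoly_ceval h ((1/z) *s (of_real r *s a + b) + c) = (1/z) ^ d * f r z"
        unfolding f_def mpoly_ceval_scale[OF hom, symmetric] using z0
        by (intro arg_cong[where f = "mpoly_ceval h"])
           (simp add: vec_eq_iff field_simps)
      ultimately show False using fz by simp
    qed
    moreover have "L > 0" using \<epsilon>(1) by (simp add: L_def add_pos_pos)
    ultimately show ?thesis using that by blast
  qed
  obtain m where m: "m > 0" "\<And>r x. 0 \<le> r \<Longrightarrow> r \<le> 1 \<Longrightarrow> \<bar>x\<bar> \<le> L \<Longrightarrow> m \<le> cmod (f r (of_real x))"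
  proof -
    let ?S = "{0..1::real} \<times> {-L..L}"
    have "continuous_on ?S (\<lambda>x. cmod (f (fst x) (of_real (snd x))))"
      unfolding f_def by (intro continuous_intros)
    moreover have "compact ?S" "?S \<noteq> {}" using L by (auto intro: compact_Times)
    ultimately obtain p where p: "p \<in> ?S"
      "\<And>q. q \<in> ?S \<Longrightarrow> cmod (f (fst p) (of_real (snd p))) \<le> cmod (f (fst q) (of_real (snd q)))"
      using continuous_attains_inf[of ?S "\<lambda>x. cmod (f (fst x) (of_real (snd x)))"] by auto
    have "f (fst p) (of_real (snd p)) \<noteq> 0"
      using p(1) nonreal[of "fst p" "snd p"] by (auto simp: f_def)
    then show ?thesis using p(2) that[of "cmod (f (fst p) (of_real (snd p)))"]
      by (force simp: abs_le_iff)
  qed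
  have "uniformly_continuous_on ({0..1} \<times> cball 0 L) (\<lambda>(r, z). f r z)"
    by (intro compact_uniformly_continuous compact_Times continuous_on_subset[OF cont]) auto
  then obtain \<delta> where \<delta>: "\<delta> > 0" "\<And>x x'. x \<in> {0..1} \<times> cball 0 L \<Longrightarrow> x' \<in> {0..1} \<times> cball 0 L \<Longrightarrow>
      dist x' x < \<delta> \<Longrightarrow> dist ((\<lambda>(r, z). f r z) x') ((\<lambda>(r, z). f r z) x) < m"
    using m(1) by (elim uniformly_continuous_onE) auto
  define good where "good r \<longleftrightarrow> (\<forall>z. Im z \<ge> 0 \<longrightarrow> f r z \<noteq> 0)" for r
  have step: "good r'" if "good r" "0 \<le> r" "r \<le> 1" "0 \<le> r'" "r' \<le> 1" "\<bar>r' - r\<bar> < \<delta>" for r r'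
    unfolding good_def
  proof (intro allI impI)
    fix z assume z: "Im z \<ge> 0"
    show "f r' z \<noteq> 0"
    proof (cases "cmod z > L")
      case False
      obtain p where p: "\<And>\<zeta>. poly p \<zeta> = f r \<zeta>"
        using mpoly_ceval_line[of h "of_real r *s a + b" c] unfolding f_def by metis
      have "m \<le> cmod (f r (of_real (Re z)))"
        using m(2)[of r "Re z"] that False abs_Re_le_cmod[of z] by simp
      also have "\<dots> \<le> cmod (f r z)"
        using norm_poly_mono_upper[of p z] \<open>good r\<close> z by (simp add: p good_def)
      finally have "m \<le> cmod (f r z)" .
      moreover have "dist (f r' z) (f r z) < m"
        using \<delta>(2)[of "(r, z)" "(r', z)"] that False by (auto simp: dist_Pair_Pair dist_real_def)
      ultimately show ?thesis by auto
    qed (use L that in auto)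
  qed
  obtain N :: nat where N: "N > 0" "1 / real N < \<delta>"
    using \<delta>(1) by (metis nat_approx_posE zero_less_Suc)
  have "good (real k / real N)" if "k \<le> N" for k
    using that
  proof (induction k)
    case 0
    then show ?case using start by (simp add: good_def f_def)
  next
    case (Suc k)
    show ?case
    proof (rule step[OF Suc.IH])
      have "real (Suc k) / real N - real k / real N = 1 / real N"
        by (simp add: add_divide_distrib)
      then show "\<bar>real (Suc k) / real N - real k / real N\<bar> < \<delta>" using N by simp
    qed (use Suc.prems N in auto)
  qed
  from this[of N] N have "good 1" by simp
  then show ?thesis using z by (simp add: good_def f_def)
qed

locale hyperbolic_polynomial =
  fixes d :: nat and h :: "'m::finite mpoly" and e :: "real ^ 'm"
  assumes hyp: "hyperbolic d h e"
begin

lemma hom: "homogeneous_mpoly d h" and h_e_pos: "mpoly_eval h e > 0"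
  using hyp by (auto simp: hyperbolic_def)

lemma nonreal_line:
  assumes "z \<notin> \<real>"
  shows "mpoly_ceval h (cvec x + z *s cvec e) \<noteq> 0"
proof -
  have "real_rooted (hyp_charpoly h e (- x))" using hyp by (simp add: hyperbolic_def)
  then show ?thesis
    using assms map_poly_hyp_charpoly[of h e "- x" z] by (auto simp: real_rooted_def add.commute)
qed

text \<open>
  Equivalently, no eigenvalue of \<open>v\<close> is negative.  The zeros of \<open>h\<close> are used directly because Garding's
  argument below speaks about zeros of \<open>h\<close> at real and complex points alike.
\<close>

definition cone :: "(real ^ 'm) set" where
  "cone = {v. \<forall>t>0. mpoly_eval h (v + t *\<^sub>R e) \<noteq> 0}"

text \<open>
  The imaginary parts that are harmless after adding any positive multiple of \<open>e\<close>.  They turn out to be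
  exactly the cone, and this is how convexity of the cone is obtained: \<open>hyp_dirs\<close> absorbs the addition
  of cone elements.
\<close>

definition hyp_dirs :: "(real ^ 'm) set" where
  "hyp_dirs = {V. \<forall>X. \<forall>\<alpha>>0. mpoly_ceval h (cvec X + \<i> *s cvec (\<alpha> *\<^sub>R e + V)) \<noteq> 0}"

lemma hyp_dirs_subset_cone: "hyp_dirs \<subseteq> cone"
proof
  fix V assume V: "V \<in> hyp_dirs"
  have "mpoly_eval h (V + t *\<^sub>R e) \<noteq> 0" if "t > 0" for t
  proof -
    have "mpoly_ceval h (cvec 0 + \<i> *s cvec (t *\<^sub>R e + V)) \<noteq> 0"
      using V that unfolding hyp_dirs_def by blast
    then show ?thesis
      by (simp only: cvec_simps(1) add_0 mpoly_ceval_scale[OF hom] mpoly_ceval_cvec add.commute) simp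
  qed
  then show "V \<in> cone" by (simp add: cone_def)
qed

lemma zero_hyp_dirs: "0 \<in> hyp_dirs"
  unfolding hyp_dirs_def
proof (intro CollectI allI impI)
  fix X and \<alpha> :: real assume "\<alpha> > 0"
  then have "\<i> * complex_of_real \<alpha> \<notin> \<real>" by (simp add: complex_is_Real_iff)
  from nonreal_line[OF this, of X] show "mpoly_ceval h (cvec X + \<i> *s cvec (\<alpha> *\<^sub>R e + 0)) \<noteq> 0"
    by simp
qed

lemma hyp_dirs_scale:
  assumes V: "V \<in> hyp_dirs" and r: "r \<ge> 0"
  shows "r *\<^sub>R V \<in> hyp_dirs"
proof (cases "r = 0")
  case False
  with r have r: "r > 0" by simp
  show ?thesis
    unfolding hyp_dirs_def
  proof (intro CollectI allI impI)
    fix X and \<alpha> :: real assume \<alpha>: "\<alpha> > 0"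
    have "cvec X + \<i> *s cvec (\<alpha> *\<^sub>R e + r *\<^sub>R V) =
        of_real r *s (cvec ((1/r) *\<^sub>R X) + \<i> *s cvec ((\<alpha>/r) *\<^sub>R e + V))"
      using r by (simp add: vec_eq_iff field_simps)
    moreover have "mpoly_ceval h (cvec ((1/r) *\<^sub>R X) + \<i> *s cvec ((\<alpha>/r) *\<^sub>R e + V)) \<noteq> 0"
      using V \<alpha> r unfolding hyp_dirs_def by (metis (mono_tags, lifting) divide_pos_pos mem_Collect_eq)
    ultimately show "mpoly_ceval h (cvec X + \<i> *s cvec (\<alpha> *\<^sub>R e + r *\<^sub>R V)) \<noteq> 0"
      using r by (simp only: mpoly_ceval_scale[OF hom]) simp
  qed
qed (simp add: zero_hyp_dirs)

text \<open>
  Garding's argument.  With \<open>c = v + \<epsilon> e\<close>, the roots of \<open>z \<mapsto> h (r (X + \<i> V) + \<i> \<epsilon> e + z c)\<close> are never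
  real, since \<open>V\<close> is harmless; for \<open>r = 0\<close> they are \<open>- \<i> \<epsilon> / \<lambda>\<close> with \<open>\<lambda>\<close> an eigenvalue of \<open>c\<close>,
  which is positive.  So for \<open>r = 1\<close> the point \<open>z = \<i>\<close> is not a root.
\<close>

lemma hyp_dirs_add_cone:
  assumes V: "V \<in> hyp_dirs" and v: "v \<in> cone"
  shows "V + v \<in> hyp_dirs"
  unfolding hyp_dirs_def
proof (intro CollectI allI impI)
  fix X and \<alpha> :: real assume \<alpha>: "\<alpha> > 0"
  define \<epsilon> where "\<epsilon> = \<alpha> / 2"
  have \<epsilon>: "\<epsilon> > 0" using \<alpha> by (simp add: \<epsilon>_def)
  define c where "c = v + \<epsilon> *\<^sub>R e"
  have "mpoly_ceval h ((cvec X + \<i> *s cvec V) + (\<i> * of_real \<epsilon>) *s cvec e + \<i> *s cvec c) \<noteq> 0"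
  proof (rule roots_stay_below[OF hom])
    show "mpoly_ceval h (cvec c) \<noteq> 0"
      using v \<epsilon> by (auto simp: c_def cone_def simp del: cvec_simps)
    show "mpoly_ceval h (of_real r *s (cvec X + \<i> *s cvec V) + (\<i> * of_real \<epsilon>) *s cvec e
        + complex_of_real t *s cvec c) \<noteq> 0" if r: "0 \<le> r" "r \<le> 1" for r t
    proof -
      have "of_real r *s (cvec X + \<i> *s cvec V) + (\<i> * of_real \<epsilon>) *s cvec e + complex_of_real t *s cvec c
          = cvec (r *\<^sub>R X + t *\<^sub>R c) + \<i> *s cvec (\<epsilon> *\<^sub>R e + r *\<^sub>R V)"
        by (simp add: vec_eq_iff algebra_simps)
      moreover have "mpoly_ceval h (cvec (r *\<^sub>R X + t *\<^sub>R c) + \<i> *s cvec (\<epsilon> *\<^sub>R e + r *\<^sub>R V)) \<noteq> 0"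
        using hyp_dirs_scale[OF V, of r] \<epsilon> r unfolding hyp_dirs_def by blast
      ultimately show ?thesis by (simp only: not_False_eq_True)
    qed
    show "mpoly_ceval h ((\<i> * of_real \<epsilon>) *s cvec e + z *s cvec c) \<noteq> 0" if z: "Im z \<ge> 0" for z
    proof (cases "z = 0")
      case True
      then show ?thesis
        using h_e_pos \<epsilon> by (simp add: mpoly_ceval_scale[OF hom])
    next
      case False
      define w where "w = \<i> * of_real \<epsilon> / z"
      have eq: "(\<i> * of_real \<epsilon>) *s cvec e + z *s cvec c = z *s (cvec c + w *s cvec e)"
        using False by (simp add: w_def vec_eq_iff field_simps)
      have "mpoly_ceval h (cvec c + w *s cvec e) \<noteq> 0"
      proof (cases "w \<in> \<real>")
        case True
        then obtain t where t: "w = of_real t" by (auto elim: Reals_cases)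
        \<comment> \<open>A real \<open>w = \<i>\<epsilon>/z\<close> with \<open>Im z \<ge> 0\<close> is positive.\<close>
        have "t \<noteq> 0" using t \<epsilon> False by (auto simp: w_def)
        have "z = \<i> * of_real \<epsilon> / w" using False \<epsilon> by (simp add: w_def)
        then have "Im z = \<epsilon> / t" by (simp add: t)
        with z \<epsilon> \<open>t \<noteq> 0\<close> have "t > 0" by (simp add: zero_le_divide_iff)
        then have "mpoly_eval h (v + (\<epsilon> + t) *\<^sub>R e) \<noteq> 0" using v \<epsilon> by (simp add: cone_def)
        moreover have "cvec c + w *s cvec e = cvec (v + (\<epsilon> + t) *\<^sub>R e)"
          by (simp add: t c_def vec_eq_iff algebra_simps)
        ultimately show ?thesis by (simp del: cvec_simps)
      qed (rule nonreal_line)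
      then show ?thesis using False by (simp only: eq mpoly_ceval_scale[OF hom]) simp
    qed
  qed simp
  moreover have "(cvec X + \<i> *s cvec V) + (\<i> * of_real \<epsilon>) *s cvec e + \<i> *s cvec c =
      cvec X + \<i> *s cvec (\<alpha> *\<^sub>R e + (V + v))"
    by (simp add: c_def \<epsilon>_def vec_eq_iff algebra_simps)
  ultimately show "mpoly_ceval h (cvec X + \<i> *s cvec (\<alpha> *\<^sub>R e + (V + v))) \<noteq> 0" by simp
qed

lemma hyp_dirs_eq_cone: "hyp_dirs = cone"
  using hyp_dirs_subset_cone hyp_dirs_add_cone[OF zero_hyp_dirs] by auto

lemma cone_zero [simp]: "0 \<in> cone" and
  cone_add: "v \<in> cone \<Longrightarrow> w \<in> cone \<Longrightarrow> v + w \<in> cone" and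
  cone_scale: "v \<in> cone \<Longrightarrow> r \<ge> 0 \<Longrightarrow> r *\<^sub>R v \<in> cone"
  using zero_hyp_dirs hyp_dirs_add_cone hyp_dirs_scale by (auto simp: hyp_dirs_eq_cone)

lemma cone_e: "t \<ge> 0 \<Longrightarrow> t *\<^sub>R e \<in> cone"
proof -
  have "e \<in> cone"
  proof -
    have "mpoly_eval h (e + t *\<^sub>R e) \<noteq> 0" if "t > 0" for t
    proof -
      have "e + t *\<^sub>R e = (1 + t) *\<^sub>R e" by (simp add: algebra_simps)
      then show ?thesis using h_e_pos that by (simp add: mpoly_eval_scale[OF hom])
    qed
    then show ?thesis by (simp add: cone_def)
  qed
  then show "t \<ge> 0 \<Longrightarrow> t *\<^sub>R e \<in> cone" by (rule cone_scale)
qed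

lemma cone_pos:
  assumes v: "v \<in> cone" and t: "t > 0"
  shows "mpoly_eval h (v + t *\<^sub>R e) > 0"
proof (rule ccontr)
  let ?p = "hyp_charpoly h e (- v)"
  have ev: "poly ?p s = mpoly_eval h (v + s *\<^sub>R e)" for s
    by (simp add: poly_hyp_charpoly add.commute)
  assume "\<not> mpoly_eval h (v + t *\<^sub>R e) > 0"
  then have neg: "poly ?p t < 0" using v t by (auto simp: ev cone_def not_less le_less)
  have "coeff ?p d > 0" "degree ?p \<le> d"
    using hyp_charpoly_top[OF hom, of e "- v"] h_e_pos by auto
  then have "lead_coeff ?p > 0" using le_degree[of ?p d] by force
  then obtain n where "\<forall>x\<ge>n. lead_coeff ?p \<le> poly ?p x" using poly_pinfty_gt_lc by blast
  then have "lead_coeff ?p \<le> poly ?p (max n (t + 1))" by simp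
  then have "poly ?p (max n (t + 1)) > 0" using \<open>lead_coeff ?p > 0\<close> by linarith
  then obtain s where "s > t" "poly ?p s = 0"
    using poly_IVT_pos[of t "max n (t + 1)" ?p] neg
    by (metis less_add_one less_max_iff_disj)
  then show False using v t by (auto simp: ev cone_def)
qed

definition tube :: "(complex ^ 'm) set" where
  "tube = {cvec X + \<i> *s cvec (\<alpha> *\<^sub>R e + V) | X \<alpha> V. \<alpha> > 0 \<and> V \<in> cone}"

lemma tubeI: "\<alpha> > 0 \<Longrightarrow> V \<in> cone \<Longrightarrow> Z = cvec X + \<i> *s cvec (\<alpha> *\<^sub>R e + V) \<Longrightarrow> Z \<in> tube"
  by (auto simp: tube_def)

lemma tube_nonzero: "Z \<in> tube \<Longrightarrow> mpoly_ceval h Z \<noteq> 0"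
  using hyp_dirs_eq_cone unfolding tube_def hyp_dirs_def by blast

lemma tube_add_cone:
  assumes "Z \<in> tube" "v \<in> cone" "Im z \<ge> 0"
  shows "Z + z *s cvec v \<in> tube"
proof -
  obtain X \<alpha> V where Z: "\<alpha> > 0" "V \<in> cone" "Z = cvec X + \<i> *s cvec (\<alpha> *\<^sub>R e + V)"
    using assms(1) by (auto simp: tube_def)
  show ?thesis
  proof (rule tubeI[OF Z(1)])
    show "V + Im z *\<^sub>R v \<in> cone" using Z assms by (intro cone_add cone_scale)
    show "Z + z *s cvec v = cvec (X + Re z *\<^sub>R v) + \<i> *s cvec (\<alpha> *\<^sub>R e + (V + Im z *\<^sub>R v))"
      unfolding Z(3) by (simp add: vec_eq_iff algebra_simps complex_eq_iff)
  qed
qed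

lemma tube_e: "Im z > 0 \<Longrightarrow> cvec x + z *s cvec e \<in> tube"
  by (rule tubeI[of "Im z" 0 _ "x + Re z *\<^sub>R e"]) (auto simp: vec_eq_iff algebra_simps complex_eq_iff)

text \<open>
  The restriction of \<open>h\<close> to the line \<open>v + t e + s w\<close> is positive for \<open>s \<ge> 0\<close> and real-rooted: for
  nonreal \<open>z\<close> a suitable complex multiple of \<open>v + t e + z w\<close> is in the tube.
\<close>

lemma mono_on_cone:
  assumes a: "v \<in> cone" "t > 0" and b: "w \<in> cone"
  shows "mpoly_eval h (v + t *\<^sub>R e) \<le> mpoly_eval h (v + t *\<^sub>R e + w)"
proof -
  let ?p = "hyp_charpoly h w (- (v + t *\<^sub>R e))"
  have ev: "poly ?p s = mpoly_eval h (v + t *\<^sub>R e + s *\<^sub>R w)" for s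
    by (simp add: poly_hyp_charpoly algebra_simps)
  have "poly ?p 0 \<le> poly ?p 1"
  proof (rule real_rooted_mono)
    show "poly ?p s > 0" if "s \<ge> 0" for s
      using cone_pos[OF cone_add[OF a(1) cone_scale[OF b that]] a(2)] unfolding ev by (simp add: algebra_simps)
    show "real_rooted ?p"
      unfolding real_rooted_def
    proof (intro allI impI, rule ccontr)
      fix z assume root: "poly (map_poly complex_of_real ?p) z = 0" and "z \<notin> \<real>"
      then have Imz: "Im z \<noteq> 0" by (simp add: complex_is_Real_iff)
      \<comment> \<open>Rotate so that \<open>c\<close> lies in the open and \<open>c z\<close> in the closed upper half-plane.\<close>
      obtain c where c: "Im c > 0" "Im (c * z) \<ge> 0"
      proof (cases "Im z > 0")
        case True
        have "Im (Complex (\<bar>Re z\<bar> / Im z) 1 * z) \<ge> 0" using True by (simp add: field_simps)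
        then show ?thesis using that[of "Complex (\<bar>Re z\<bar> / Im z) 1"] by simp
      next
        case False
        then have "Im z < 0" using Imz by simp
        then have "Im (Complex (- \<bar>Re z\<bar> / - Im z) 1 * z) \<ge> 0" by (simp add: field_simps)
        then show ?thesis using that[of "Complex (- \<bar>Re z\<bar> / - Im z) 1"] by simp
      qed
      have "c *s cvec (v + t *\<^sub>R e) + (c * z) *s cvec w \<in> tube"
      proof (rule tube_add_cone[OF _ b c(2)])
        show "c *s cvec (v + t *\<^sub>R e) \<in> tube"
          using tube_add_cone[OF tube_e[of "c * of_real t" 0] a(1), of c] c(1) a(2)
          by (simp add: vector_add_ldistrib add.commute)
      qed
      moreover have "c *s cvec (v + t *\<^sub>R e) + (c * z) *s cvec w =
          c *s (z *s cvec w - cvec (- (v + t *\<^sub>R e)))"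
        by (simp add: vec_eq_iff algebra_simps)
      ultimately have "mpoly_ceval h (c *s (z *s cvec w - cvec (- (v + t *\<^sub>R e)))) \<noteq> 0"
        using tube_nonzero by metis
      then show False using root unfolding map_poly_hyp_charpoly mpoly_ceval_scale[OF hom] by simp
    qed
  qed simp
  then show ?thesis unfolding ev by simp
qed

lemma continuous_mpoly_eval: "continuous_on S f \<Longrightarrow> continuous_on S (\<lambda>x. mpoly_eval h (f x))"
  unfolding mpoly_eval_def by (intro continuous_intros)

text \<open>
  Closedness makes the event in the theorem measurable.
\<close>

lemma closed_cone: "closed cone"
proof -
  have ge: "mpoly_eval h e * t ^ d \<le> mpoly_eval h (v + t *\<^sub>R e)" if "v \<in> cone" "t > 0" for v t
    using mono_on_cone[of 0 t v] that by (simp add: mpoly_eval_scale[OF hom] add.commute mult.commute)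
  have "cone = (\<Inter>t\<in>{0<..}. {v. mpoly_eval h e * t ^ d \<le> mpoly_eval h (v + t *\<^sub>R e)})"
  proof (intro equalityI subsetI)
    fix v assume v: "v \<in> (\<Inter>t\<in>{0<..}. {v. mpoly_eval h e * t ^ d \<le> mpoly_eval h (v + t *\<^sub>R e)})"
    have "mpoly_eval h (v + t *\<^sub>R e) \<noteq> 0" if "t > 0" for t
    proof -
      have "0 < mpoly_eval h e * t ^ d" using h_e_pos that by simp
      then show ?thesis using v that by force
    qed
    then show "v \<in> cone" by (simp add: cone_def)
  qed (use ge in auto)
  moreover have "closed {v. mpoly_eval h e * t ^ d \<le> mpoly_eval h (v + t *\<^sub>R e)}" for t
    by (intro closed_Collect_le continuous_mpoly_eval continuous_intros)
  ultimately show ?thesis by auto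
qed

lemma hyp_norm_le_iff_cone:
  assumes d: "d > 0" and b: "b \<ge> 0"
  shows "hyp_norm d h e x \<le> b \<longleftrightarrow> b *\<^sub>R e - x \<in> cone \<and> b *\<^sub>R e + x \<in> cone"
proof -
  have norm_le: "hyp_norm d h e x \<le> b \<longleftrightarrow> (\<forall>i\<in>{1..d}. \<bar>hyp_eig h e x i\<bar> \<le> b)"
    using d by (simp add: hyp_norm_def Max_le_iff)
  have char: "mpoly_eval h (t *\<^sub>R e - x) = 0 \<longleftrightarrow> (\<exists>i\<in>{1..d}. t = hyp_eig h e x i)" for t
    using h_e_pos by (auto simp: charpoly_eq_prod_eig[OF hyp])
  have neg: "mpoly_eval h (t *\<^sub>R e + x) = 0 \<longleftrightarrow> mpoly_eval h ((- t) *\<^sub>R e - x) = 0" for t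
    using mpoly_eval_scale[OF hom, of "- 1" "(- t) *\<^sub>R e - x"] by (simp add: add.commute)
  have "b *\<^sub>R e - x \<in> cone \<longleftrightarrow> (\<forall>i\<in>{1..d}. hyp_eig h e x i \<le> b)"
  proof -
    have "b *\<^sub>R e - x \<in> cone \<longleftrightarrow> (\<forall>t>0. mpoly_eval h ((b + t) *\<^sub>R e - x) \<noteq> 0)"
      by (simp add: cone_def algebra_simps)
    also have "\<dots> \<longleftrightarrow> (\<forall>i\<in>{1..d}. hyp_eig h e x i \<le> b)"
      unfolding char
      by (metis add_diff_cancel_left' add.commute diff_add_cancel diff_gt_0_iff_gt less_add_same_cancel1 not_le)
    finally show ?thesis .
  qed
  moreover have "b *\<^sub>R e + x \<in> cone \<longleftrightarrow> (\<forall>i\<in>{1..d}. - b \<le> hyp_eig h e x i)"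
  proof -
    have "b *\<^sub>R e + x \<in> cone \<longleftrightarrow> (\<forall>t>0. mpoly_eval h ((b + t) *\<^sub>R e + x) \<noteq> 0)"
      by (simp add: cone_def algebra_simps)
    also have "\<dots> \<longleftrightarrow> (\<forall>t>0. \<forall>i\<in>{1..d}. - (b + t) \<noteq> hyp_eig h e x i)"
      unfolding neg char by blast
    also have "\<dots> \<longleftrightarrow> (\<forall>i\<in>{1..d}. - b \<le> hyp_eig h e x i)"
    proof (intro iffI ballI)
      fix i assume *: "\<forall>t>0. \<forall>i\<in>{1..d}. - (b + t) \<noteq> hyp_eig h e x i" and i: "i \<in> {1..d}"
      show "- b \<le> hyp_eig h e x i"
      proof (rule ccontr)
        assume "\<not> - b \<le> hyp_eig h e x i"
        then have "- hyp_eig h e x i - b > 0" by simp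
        with * i have "- (b + (- hyp_eig h e x i - b)) \<noteq> hyp_eig h e x i" by blast
        then show False by simp
      qed
    qed force
    finally show ?thesis .
  qed
  moreover have "\<bar>y\<bar> \<le> b \<longleftrightarrow> y \<le> b \<and> - b \<le> y" for y by linarith
  ultimately show ?thesis unfolding norm_le by blast
qed

end

section \<open>Rank one directions\<close>

context hyperbolic_polynomial
begin

lemma shift_into_cone: "\<exists>M>0. x + M *\<^sub>R e \<in> cone"
proof -
  let ?p = "hyp_charpoly h e (- x)"
  have "coeff ?p d > 0" using hyp_charpoly_top[OF hom, of e "- x"] h_e_pos by auto
  then have "?p \<noteq> 0" by auto
  then have "finite {s. poly ?p s = 0}" by (rule poly_roots_finite)
  then obtain b where b: "\<And>s. poly ?p s = 0 \<Longrightarrow> s \<le> b"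
    using bdd_above_finite by (metis (mono_tags) bdd_above_def mem_Collect_eq)
  have "mpoly_eval h (x + max b 1 *\<^sub>R e + t *\<^sub>R e) \<noteq> 0" if "t > 0" for t
    using b[of "max b 1 + t"] that by (auto simp: poly_hyp_charpoly algebra_simps)
  then show ?thesis by (intro exI[of _ "max b 1"]) (auto simp: cone_def)
qed

text \<open>
  The consequences of having eigenvalues \<open>T, 0, \<dots>, 0\<close> with \<open>T \<ge> 0\<close> in the form in which they are used:
  the third conjunct is the characteristic polynomial in homogeneous form, the last one says that \<open>T\<close>
  bounds the largest eigenvalue.
\<close>

definition rank_one :: "real \<Rightarrow> real ^ 'm \<Rightarrow> bool" where
  "rank_one T v \<longleftrightarrow> v \<in> cone \<and> T \<ge> 0 \<and>
     (\<forall>M>0. \<forall>u\<ge>0. mpoly_eval h (M *\<^sub>R e + u *\<^sub>R v) = mpoly_eval h e * M ^ (d - 1) * (M + u * T)) \<and>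
     T *\<^sub>R e - v \<in> cone"

lemma rank_one_scale:
  assumes "rank_one T v" "r \<ge> 0"
  shows "rank_one (r * T) (r *\<^sub>R v)"
proof -
  have "r *\<^sub>R (T *\<^sub>R e - v) \<in> cone" using assms by (intro cone_scale) (auto simp: rank_one_def)
  moreover have "mpoly_eval h (M *\<^sub>R e + u *\<^sub>R (r *\<^sub>R v)) =
      mpoly_eval h e * M ^ (d - 1) * (M + u * (r * T))" if "M > 0" "u \<ge> 0" for M u
  proof -
    have "mpoly_eval h (M *\<^sub>R e + (u * r) *\<^sub>R v) = mpoly_eval h e * M ^ (d - 1) * (M + (u * r) * T)"
      using assms that unfolding rank_one_def by auto
    then show ?thesis by (simp add: mult.assoc)
  qed
  moreover have "r *\<^sub>R (T *\<^sub>R e - v) = (r * T) *\<^sub>R e - r *\<^sub>R v"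
    by (simp add: scaleR_diff_right)
  ultimately show ?thesis
    using assms cone_scale[of v r] unfolding rank_one_def by simp
qed

text \<open>
  Since \<open>w\<close> is below a multiple \<open>M e\<close> in the cone order, monotonicity gives
  \<open>0 \<le> h (w + u v) \<le> h (M e + u v)\<close> for \<open>u \<ge> 0\<close>, when \<open>w\<close> is inside the cone.  The right-hand side is
  affine in \<open>u\<close> by the rank condition, so the polynomial on the left has degree at most one.  Other \<open>w\<close>
  are reached by polynomial continuation along \<open>e\<close>.
\<close>

lemma rank_one_affine_real:
  assumes v: "rank_one T v"
  shows "mpoly_eval h (w + u *\<^sub>R v) = mpoly_eval h w + u * (mpoly_eval h (w + v) - mpoly_eval h w)"
proof -
  have vc: "v \<in> cone" using v by (simp add: rank_one_def)
  have inner: "mpoly_eval h (w + t *\<^sub>R e + u *\<^sub>R v) =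
      mpoly_eval h (w + t *\<^sub>R e) + u * (mpoly_eval h (w + t *\<^sub>R e + v) - mpoly_eval h (w + t *\<^sub>R e))"
    if w: "w \<in> cone" and t: "t > 0" for w t
  proof -
    let ?p = "hyp_charpoly h v (- (w + t *\<^sub>R e))"
    have ev: "poly ?p s = mpoly_eval h (w + t *\<^sub>R e + s *\<^sub>R v)" for s
      by (simp add: poly_hyp_charpoly algebra_simps)
    obtain M where M: "M > 0" "- (w + t *\<^sub>R e) + M *\<^sub>R e \<in> cone"
      using shift_into_cone by blast
    have le: "poly ?p s \<le> mpoly_eval h e * M ^ (d - 1) * M + (mpoly_eval h e * M ^ (d - 1) * T) * s"
      and ge: "0 \<le> poly ?p s" if s: "s \<ge> 0" for s
    proof -
      have c: "w + s *\<^sub>R v \<in> cone" using w vc s by (intro cone_add cone_scale)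
      have "poly ?p s = mpoly_eval h (w + s *\<^sub>R v + t *\<^sub>R e)" unfolding ev by (simp add: algebra_simps)
      also have "\<dots> \<le> mpoly_eval h (w + s *\<^sub>R v + t *\<^sub>R e + (- (w + t *\<^sub>R e) + M *\<^sub>R e))"
        using mono_on_cone[OF c t M(2)] .
      also have "\<dots> = mpoly_eval h (M *\<^sub>R e + s *\<^sub>R v)" by (simp add: algebra_simps)
      also have "\<dots> = mpoly_eval h e * M ^ (d - 1) * (M + s * T)"
        using v M s by (simp add: rank_one_def)
      finally show "poly ?p s \<le> mpoly_eval h e * M ^ (d - 1) * M + (mpoly_eval h e * M ^ (d - 1) * T) * s"
        by (simp add: algebra_simps)
      show "0 \<le> poly ?p s"
        using cone_pos[OF c t] unfolding ev by (simp add: algebra_simps)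
    qed
    have "degree ?p \<le> 1" by (rule poly_affine_bound_degree[OF ge le])
    then have "?p = [:coeff ?p 0, coeff ?p 1:]"
      by (intro poly_eqI) (auto simp: coeff_pCons coeff_eq_0 split: nat.splits)
    then obtain a b where "?p = [:a, b:]" by blast
    then have "poly ?p u = poly ?p 0 + u * (poly ?p 1 - poly ?p 0)" by simp
    then show ?thesis unfolding ev by simp
  qed
  \<comment> \<open>Both sides are polynomials in the shift along \<open>e\<close>, and they agree for large shifts.\<close>
  obtain M where M: "M > 0" "w + M *\<^sub>R e \<in> cone" using shift_into_cone by blast
  define P where "P x = hyp_charpoly h e (- x)" for x
  have P: "poly (P x) s = mpoly_eval h (x + s *\<^sub>R e)" for x s
    by (simp add: P_def poly_hyp_charpoly add.commute)
  have "P (w + u *\<^sub>R v) - P w - smult u (P (w + v) - P w) = 0"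
  proof (rule poly_zero_on_ray)
    fix s assume s: "s > M"
    have "poly (P (w + u *\<^sub>R v)) s = mpoly_eval h (w + M *\<^sub>R e + (s - M) *\<^sub>R e + u *\<^sub>R v)"
      "poly (P w) s = mpoly_eval h (w + M *\<^sub>R e + (s - M) *\<^sub>R e)"
      "poly (P (w + v)) s = mpoly_eval h (w + M *\<^sub>R e + (s - M) *\<^sub>R e + v)"
      by (simp_all add: P algebra_simps)
    then show "poly (P (w + u *\<^sub>R v) - P w - smult u (P (w + v) - P w)) s = 0"
      using inner[OF M(2), of "s - M"] s by simp
  qed
  then have "poly (P (w + u *\<^sub>R v) - P w - smult u (P (w + v) - P w)) 0 = 0" by simp
  then show ?thesis by (simp add: P)
qed

text \<open>
  A polynomial identity on real points persists at complex points: first in the imaginary part of \<open>Z\<close>,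
  then in \<open>z\<close>.
\<close>

lemma rank_one_affine:
  assumes v: "rank_one T v"
  shows "mpoly_ceval h (Z + z *s cvec v) =
    mpoly_ceval h Z + z * (mpoly_ceval h (Z + cvec v) - mpoly_ceval h Z)"
proof -
  obtain X Y where Z: "Z = cvec X + \<i> *s cvec Y"
  proof
    show "Z = cvec (\<chi> i. Re (Z $ i)) + \<i> *s cvec (\<chi> i. Im (Z $ i))"
      by (simp add: vec_eq_iff cvec_def complex_eq_iff)
  qed
  have real_z: "mpoly_ceval h (Z + of_real u *s cvec v) =
      mpoly_ceval h Z + of_real u * (mpoly_ceval h (Z + cvec v) - mpoly_ceval h Z)" for u :: real
  proof -
    have "\<forall>x. \<exists>p. \<forall>\<zeta>. poly p \<zeta> = mpoly_ceval h (cvec x + \<zeta> *s cvec Y)"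
      using mpoly_ceval_line[of h] by metis
    then obtain P where P: "\<And>x \<zeta>. poly (P x) \<zeta> = mpoly_ceval h (cvec x + \<zeta> *s cvec Y)"
      by metis
    have "P (X + u *\<^sub>R v) - P X - smult (of_real u) (P (X + v) - P X) = 0"
    proof (rule poly_zero_on_reals)
      fix s :: real
      have c: "poly (P x) (of_real s) = of_real (mpoly_eval h (x + s *\<^sub>R Y))" for x
        by (simp add: P flip: mpoly_ceval_cvec)
      have "mpoly_eval h (X + u *\<^sub>R v + s *\<^sub>R Y) = mpoly_eval h (X + s *\<^sub>R Y) +
          u * (mpoly_eval h (X + v + s *\<^sub>R Y) - mpoly_eval h (X + s *\<^sub>R Y))"
        using rank_one_affine_real[OF v, of "X + s *\<^sub>R Y" u] by (simp add: algebra_simps)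
      then show "poly (P (X + u *\<^sub>R v) - P X - smult (of_real u) (P (X + v) - P X)) (of_real s) = 0"
        by (simp add: c)
    qed
    then have "poly (P (X + u *\<^sub>R v) - P X - smult (of_real u) (P (X + v) - P X)) \<i> = 0" by simp
    then show ?thesis by (simp add: P Z algebra_simps)
  qed
  obtain Q where Q: "\<And>\<zeta>. poly Q \<zeta> = mpoly_ceval h (Z + \<zeta> *s cvec v)"
    using mpoly_ceval_line[of h Z "cvec v"] by blast
  let ?L = "[:mpoly_ceval h Z, mpoly_ceval h (Z + cvec v) - mpoly_ceval h Z:]"
  have "Q - ?L = 0" by (rule poly_zero_on_reals) (simp add: Q real_z)
  then have "Q = ?L" by simp
  then show ?thesis using Q[of z] by simp
qed

lemma rank_one_of_hyp_rank:
  assumes d: "d > 0" and v: "v \<in> hyp_cone d h e" "hyp_rank d h e v \<le> 1"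
  shows "rank_one (hyp_trace d h e v) v"
proof -
  let ?l = "hyp_eig h e v" and ?T = "hyp_trace d h e v"
  have nonneg: "?l i \<ge> 0" if "i \<in> {1..d}" for i
  proof -
    have "hyp_eigs h e v ! (i - 1) \<ge> hyp_eigs h e v ! (d - 1)"
    proof (cases "i = d")
      case False
      then show ?thesis
        using sorted_wrt_nth_less[OF hyperbolic_eigs(3)[OF hyp, of v], of "i - 1" "d - 1"] that
        by (auto simp: hyperbolic_eigs(1)[OF hyp])
    qed simp
    then show ?thesis using v(1) by (simp add: hyp_cone_def hyp_eig_def)
  qed
  have T: "?T \<ge> 0" unfolding hyp_trace_def by (rule sum_nonneg) (rule nonneg)
  have char: "mpoly_eval h (t *\<^sub>R e - v) = mpoly_eval h e * (t ^ (d - 1) * (t - ?T))" for t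
  proof -
    have "(\<Prod>i = 1..d. t - ?l i) = t ^ (d - 1) * (t - ?T)"
    proof (cases "\<exists>j\<in>{1..d}. ?l j \<noteq> 0")
      case True
      then obtain j where j: "j \<in> {1..d}" "?l j \<noteq> 0" by blast
      have z: "?l i = 0" if "i \<in> {1..d} - {j}" for i
      proof (rule ccontr)
        assume "?l i \<noteq> 0"
        then have "{i, j} \<subseteq> {i \<in> {1..d}. ?l i \<noteq> 0}" using that j by auto
        then have "card {i, j} \<le> hyp_rank d h e v"
          unfolding hyp_rank_def by (intro card_mono) auto
        then show False using v(2) that by auto
      qed
      have "?T = ?l j + (\<Sum>i\<in>{1..d} - {j}. ?l i)"
        unfolding hyp_trace_def using j by (intro sum.remove) auto
      also have "(\<Sum>i\<in>{1..d} - {j}. ?l i) = 0" using z by (intro sum.neutral) auto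
      finally have Tj: "?T = ?l j" by simp
      have "(\<Prod>i = 1..d. t - ?l i) = (t - ?l j) * (\<Prod>i\<in>{1..d} - {j}. t - ?l i)"
        using j by (intro prod.remove) auto
      also have "(\<Prod>i\<in>{1..d} - {j}. t - ?l i) = (\<Prod>i\<in>{1..d} - {j}. t)"
        using z by (intro prod.cong) auto
      also have "\<dots> = t ^ (d - 1)" using j by simp
      finally show ?thesis by (simp add: Tj)
    next
      case False
      then have "?T = 0" "(\<Prod>i = 1..d. t - ?l i) = t ^ d"
        by (auto simp: hyp_trace_def)
      then show ?thesis using d by (cases d) auto
    qed
    then show ?thesis by (simp add: charpoly_eq_prod_eig[OF hyp])
  qed
  have rank: "mpoly_eval h (M *\<^sub>R e + u *\<^sub>R v) = mpoly_eval h e * M ^ (d - 1) * (M + u * ?T)"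
    if "M > 0" "u \<ge> 0" for M u
  proof (cases "u = 0")
    case True
    then show ?thesis
      using d by (cases d) (auto simp: mpoly_eval_scale[OF hom])
  next
    case False
    obtain k where k: "d = Suc k" using d by (cases d) auto
    have "M *\<^sub>R e + u *\<^sub>R v = (- u) *\<^sub>R ((- M / u) *\<^sub>R e - v)"
      using False by (simp add: algebra_simps)
    then have "mpoly_eval h (M *\<^sub>R e + u *\<^sub>R v) =
        (- u) ^ d * (mpoly_eval h e * ((- M / u) ^ (d - 1) * (- M / u - ?T)))"
      by (simp only: mpoly_eval_scale[OF hom] char)
    also have "\<dots> = mpoly_eval h e * ((- u * (- M / u)) ^ (d - 1)) * ((- u) * (- M / u - ?T))"
      unfolding power_mult_distrib by (simp add: k)
    also have "\<dots> = mpoly_eval h e * M ^ (d - 1) * (M + u * ?T)"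
      using False by (simp add: field_simps)
    finally show ?thesis .
  qed
  have "v \<in> cone"
    using rank[of _ 1] h_e_pos T by (auto simp: cone_def add.commute add_nonneg_eq_0_iff add_pos_nonneg)
  moreover have "?T *\<^sub>R e - v \<in> cone"
  proof -
    have "mpoly_eval h (?T *\<^sub>R e - v + t *\<^sub>R e) \<noteq> 0" if "t > 0" for t
      using char[of "?T + t"] T that h_e_pos by (simp add: algebra_simps)
    then show ?thesis by (simp add: cone_def)
  qed
  ultimately show ?thesis using rank T by (simp add: rank_one_def)
qed

end

section \<open>Mixed products and their zeros\<close>

text \<open>
  A case of the Lieb--Sokal lemma.  If \<open>f (z, z') = a + b z + b' z' + c z z'\<close> has no zero with both
  arguments in the closed upper half-plane, then the average of \<open>f (1, -1)\<close> and \<open>f (-1, 1)\<close>, which is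
  \<open>a - c\<close>, is not zero.  Otherwise scale to \<open>a = c = 1\<close>; the equation \<open>f = 0\<close> then describes a Moebius
  map \<open>z' \<mapsto> z\<close> with pole \<open>- B\<close> and value \<open>- 1 / B\<close> at \<open>0\<close>.  One of these two points yields a zero in the
  forbidden region, depending on the sign of \<open>Im B\<close>.
\<close>

lemma biaffine_diff_nonzero:
  fixes a b b' c :: complex
  assumes nz: "\<And>z z'. Im z \<ge> 0 \<Longrightarrow> Im z' \<ge> 0 \<Longrightarrow> a + z * b + z' * b' + z * z' * c \<noteq> 0"
  shows "a - c \<noteq> 0"
proof
  assume "a - c = 0"
  then have c: "c = a" by simp
  have a: "a \<noteq> 0" using nz[of 0 0] by simp
  define B B' where "B = b / a" and "B' = b' / a"
  have f: "1 + z * B + z' * B' + z * z' \<noteq> 0" if "Im z \<ge> 0" "Im z' \<ge> 0" for z z'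
  proof -
    have "a + z * b + z' * b' + z * z' * c = a * (1 + z * B + z' * B' + z * z')"
      using a by (simp add: B_def B'_def c field_simps)
    then show ?thesis using nz[OF that] by auto
  qed
  show False
  proof (cases "B \<noteq> 0 \<and> Im B \<ge> 0")
    case True
    have "Im (- 1 / B) \<ge> 0" using True by (simp add: Im_divide)
    from f[OF this, of 0] True show False by simp
  next
    case False
    define D where "D = 1 - B * B'"
    have D: "D \<noteq> 0" if "Im (- B) \<ge> 0" using f[of 0 "- B"] that by (simp add: D_def)
    have ImB: "Im (- B) \<ge> 0" "B = 0 \<or> Im (- B) > 0" using False by auto
    \<comment> \<open>Solve \<open>f = 0\<close> for \<open>z\<close> near the pole \<open>z' = - B\<close>, approaching it in the direction that sends
        \<open>z\<close> to \<open>\<i>\<infinity>\<close>.\<close>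
    define \<epsilon> where "\<epsilon> = (if B = 0 then 1 / (\<bar>Im B'\<bar> + 1)
      else min (1 / (\<bar>Im B'\<bar> + 1)) (Im (- B) / (\<bar>Re D\<bar> + 1)))"
    have \<epsilon>: "\<epsilon> > 0" "\<epsilon> \<le> 1 / (\<bar>Im B'\<bar> + 1)" using ImB by (auto simp: \<epsilon>_def divide_neg_pos)
    define z' where "z' = - B + \<i> * of_real \<epsilon> * D"
    define z where "z = - B' + \<i> / of_real \<epsilon>"
    have "Im z' \<ge> 0"
    proof (cases "B = 0")
      case True
      then show ?thesis using \<epsilon> by (simp add: z'_def D_def)
    next
      case False
      have "\<epsilon> * (\<bar>Re D\<bar> + 1) \<le> Im (- B)"
        using False \<epsilon>(1) by (simp add: \<epsilon>_def min_le_iff_disj pos_le_divide_eq[symmetric])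
      moreover have "\<epsilon> * (- Re D) \<le> \<epsilon> * (\<bar>Re D\<bar> + 1)" using \<epsilon>(1) by (intro mult_left_mono) auto
      ultimately show ?thesis by (simp add: z'_def)
    qed
    moreover have "Im z \<ge> 0"
    proof -
      have "\<bar>Im B'\<bar> + 1 \<le> 1 / \<epsilon>" using \<epsilon> by (simp add: field_simps)
      moreover have "Im z = 1 / \<epsilon> - Im B'" by (simp add: z_def)
      ultimately show ?thesis by linarith
    qed
    moreover have "1 + z * B + z' * B' + z * z' = 0"
    proof -
      have "1 + z * B + z' * B' + z * z' = (z + B') * (z' + B) + D" by (simp add: D_def algebra_simps)
      also have "\<dots> = 0" using \<epsilon>(1) by (simp add: z_def z'_def)
      finally show ?thesis .
    qed
    ultimately show False using f by blast
  qed
qed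

text \<open>
  The average of \<open>H (Z + y) * H (Z' - y)\<close> over all signed sums \<open>y\<close> of the vectors \<open>us\<close>.  For \<open>H\<close> affine
  along the vectors it is a mixed characteristic polynomial: each averaging acts as
  \<open>1 - \<partial>\<^sub>z \<partial>\<^sub>z\<^sub>'\<close> at \<open>z = z' = 0\<close> on \<open>H (Z + z u) * H (Z' + z' u)\<close>.  Two independent arguments are kept because
  zero-freeness in both of them is the property that the averaging preserves.
\<close>

fun mixed :: "('v::ab_group_add \<Rightarrow> 'a::field) \<Rightarrow> 'v list \<Rightarrow> 'v \<Rightarrow> 'v \<Rightarrow> 'a" where
  "mixed H [] Z Z' = H Z * H Z'"
| "mixed H (u # us) Z Z' = (mixed H us (Z + u) (Z' - u) + mixed H us (Z - u) (Z' + u)) / 2"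

lemma mixed_commute: "mixed H us Z Z' = mixed H us Z' Z"
  by (induction us arbitrary: Z Z') (auto simp: add.commute)

context hyperbolic_polynomial
begin

definition rank_one_vecs :: "(real ^ 'm) set" where
  "rank_one_vecs = {v. \<exists>T. rank_one T v}"

lemma rank_one_vecs_cone: "v \<in> rank_one_vecs \<Longrightarrow> v \<in> cone"
  by (auto simp: rank_one_vecs_def rank_one_def)

lemma rank_one_vecs_scale: "v \<in> rank_one_vecs \<Longrightarrow> r \<ge> 0 \<Longrightarrow> r *\<^sub>R v \<in> rank_one_vecs"
  using rank_one_scale by (auto simp: rank_one_vecs_def)

abbreviation cmixed :: "(real ^ 'm) list \<Rightarrow> complex ^ 'm \<Rightarrow> complex ^ 'm \<Rightarrow> complex" where
  "cmixed us \<equiv> mixed (mpoly_ceval h) (map cvec us)"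

abbreviation rmixed :: "(real ^ 'm) list \<Rightarrow> real ^ 'm \<Rightarrow> real ^ 'm \<Rightarrow> real" where
  "rmixed us \<equiv> mixed (mpoly_eval h) us"

lemma cmixed_cvec: "cmixed us (cvec w) (cvec w') = of_real (rmixed us w w')"
proof (induction us arbitrary: w w')
  case (Cons u us)
  then show ?case by (simp flip: cvec_simps)
qed simp

lemma cmixed_affine_left:
  assumes v: "v \<in> rank_one_vecs"
  shows "cmixed us (Z + z *s cvec v) Z' =
    cmixed us Z Z' + z * (cmixed us (Z + cvec v) Z' - cmixed us Z Z')"
proof (induction us arbitrary: Z Z')
  case Nil
  obtain T where "rank_one T v" using v by (auto simp: rank_one_vecs_def)
  from rank_one_affine[OF this, of Z z]
  have "mpoly_ceval h (Z + z *s cvec v) * mpoly_ceval h Z' =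
      (mpoly_ceval h Z + z * (mpoly_ceval h (Z + cvec v) - mpoly_ceval h Z)) * mpoly_ceval h Z'"
    by (simp only:)
  then show ?case by (simp only: mixed.simps list.map left_diff_distrib distrib_right mult.assoc)
next
  case (Cons u us)
  have *: "Z + z *s cvec v + y = (Z + y) + z *s cvec v" "Z + cvec v + y = (Z + y) + cvec v"
    "Z + z *s cvec v - y = (Z - y) + z *s cvec v" "Z + cvec v - y = (Z - y) + cvec v" for y
    by (simp_all add: algebra_simps)
  have avg: "(P + z * (P1 - P) + (Q + z * (Q1 - Q))) / 2 = (P + Q) / 2 + z * ((P1 + Q1) / 2 - (P + Q) / 2)"
    for P P1 Q Q1 :: complex by (simp add: field_simps)
  show ?case by (simp only: mixed.simps list.map *[of "cvec u"] Cons.IH avg)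
qed

lemma cmixed_affine_right:
  assumes v: "v \<in> rank_one_vecs"
  shows "cmixed us Z (Z' + z *s cvec v) =
    cmixed us Z Z' + z * (cmixed us Z (Z' + cvec v) - cmixed us Z Z')"
  using cmixed_affine_left[OF v, of us Z' z Z] by (simp add: mixed_commute)

lemma cmixed_biaffine:
  assumes v: "v \<in> rank_one_vecs"
  shows "cmixed us (Z + z *s cvec v) (Z' + z' *s cvec v) = cmixed us Z Z'
     + z * (cmixed us (Z + cvec v) Z' - cmixed us Z Z')
     + z' * (cmixed us Z (Z' + cvec v) - cmixed us Z Z')
     + z * z' * (cmixed us (Z + cvec v) (Z' + cvec v) - cmixed us (Z + cvec v) Z'
         - cmixed us Z (Z' + cvec v) + cmixed us Z Z')"
  by (simp add: cmixed_affine_left[OF v] cmixed_affine_right[OF v] algebra_simps)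

lemma rmixed_biaffine:
  assumes v: "v \<in> rank_one_vecs"
  shows "rmixed us (w + s *\<^sub>R v) (w' + s' *\<^sub>R v) = rmixed us w w'
     + s * (rmixed us (w + v) w' - rmixed us w w')
     + s' * (rmixed us w (w' + v) - rmixed us w w')
     + s * s' * (rmixed us (w + v) (w' + v) - rmixed us (w + v) w'
         - rmixed us w (w' + v) + rmixed us w w')"
proof -
  have "complex_of_real (rmixed us (w + s *\<^sub>R v) (w' + s' *\<^sub>R v)) = complex_of_real (rmixed us w w'
     + s * (rmixed us (w + v) w' - rmixed us w w')
     + s' * (rmixed us w (w' + v) - rmixed us w w')
     + s * s' * (rmixed us (w + v) (w' + v) - rmixed us (w + v) w'
         - rmixed us w (w' + v) + rmixed us w w'))"
    using cmixed_biaffine[OF v, of us "cvec w" "of_real s" "cvec w'" "of_real s'"]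
    by (simp add: cmixed_cvec flip: cvec_simps)
  then show ?thesis by (simp only: of_real_eq_iff)
qed

lemma cmixed_nonzero:
  assumes "set us \<subseteq> rank_one_vecs" "Z \<in> tube" "Z' \<in> tube"
  shows "cmixed us Z Z' \<noteq> 0"
  using assms
proof (induction us arbitrary: Z Z')
  case Nil
  then show ?case using tube_nonzero by simp
next
  case (Cons u us)
  have u: "u \<in> rank_one_vecs" using Cons.prems by simp
  let ?a = "cmixed us Z Z'" and ?b = "cmixed us (Z + cvec u) Z' - cmixed us Z Z'"
    and ?b' = "cmixed us Z (Z' + cvec u) - cmixed us Z Z'"
    and ?c = "cmixed us (Z + cvec u) (Z' + cvec u) - cmixed us (Z + cvec u) Z'
         - cmixed us Z (Z' + cvec u) + cmixed us Z Z'"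
  have "?a - ?c \<noteq> 0"
  proof (rule biaffine_diff_nonzero)
    fix z z' :: complex assume "Im z \<ge> 0" "Im z' \<ge> 0"
    then have "cmixed us (Z + z *s cvec u) (Z' + z' *s cvec u) \<noteq> 0"
      using Cons rank_one_vecs_cone[OF u] tube_add_cone by auto
    then show "?a + z * ?b + z' * ?b' + z * z' * ?c \<noteq> 0"
      unfolding cmixed_biaffine[OF u] .
  qed
  moreover have "cmixed us (Z + cvec u) (Z' - cvec u) = ?a + ?b - ?b' - ?c"
    "cmixed us (Z - cvec u) (Z' + cvec u) = ?a - ?b + ?b' - ?c"
    using cmixed_biaffine[OF u, of us Z 1 Z' "- 1"] cmixed_biaffine[OF u, of us Z "- 1" Z' 1]
    by simp_all
  then have "cmixed (u # us) Z Z' = ?a - ?c" by simp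
  ultimately show ?case by metis
qed

lemma continuous_cmixed:
  fixes f :: "real \<Rightarrow> complex ^ 'm"
  assumes "continuous_on S f" "continuous_on S g"
  shows "continuous_on S (\<lambda>x. cmixed us (f x) (g x))"
  using assms
proof (induction us arbitrary: f g)
  case Nil
  then show ?case by (auto intro!: continuous_intros)
next
  case (Cons u us)
  show ?case
    by (simp, intro continuous_intros Cons.IH Cons.prems) simp
qed

end

section \<open>The barrier argument\<close>

text \<open>
  Nonnegativity on the whole line is tested at large arguments and at the vertex.
\<close>

lemma quadratic_discriminant_le:
  fixes a b c :: real
  assumes "\<And>r. 0 \<le> c + b * r + a * r\<^sup>2"
  shows "b\<^sup>2 \<le> 4 * a * c" "0 \<le> a" "0 \<le> c"
proof -
  show c: "0 \<le> c" using assms[of 0] by simp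
  show a: "0 \<le> a"
  proof (rule ccontr)
    assume a: "\<not> 0 \<le> a"
    define r where "r = (\<bar>b\<bar> + c + 1) / (- a) + 1"
    have r: "r \<ge> 1" "(- a) * r \<ge> \<bar>b\<bar> + c + 1"
      using a c by (auto simp: r_def field_simps)
    have "(\<bar>b\<bar> + c + 1) * r \<le> (- a * r) * r" using r by (intro mult_right_mono) auto
    moreover have "b * r \<le> \<bar>b\<bar> * r" "c \<le> c * r" using r c
      by (auto intro: mult_right_mono mult_left_mono[of 1 r c, simplified])
    ultimately have "c + b * r + a * r\<^sup>2 \<le> - r" by (simp add: power2_eq_square algebra_simps)
    with assms[of r] r show False by linarith
  qed
  show "b\<^sup>2 \<le> 4 * a * c"
  proof (cases "a = 0")
    case True
    have "b = 0"
    proof (rule ccontr)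
      assume b: "b \<noteq> 0"
      have "c + b * (- (c + 1) / b) = - 1" using b by simp
      with assms[of "- (c + 1) / b"] True show False by simp
    qed
    with True show ?thesis by simp
  next
    case False
    with a have a: "a > 0" by simp
    have "c + b * (- b / (2 * a)) + a * (- b / (2 * a))\<^sup>2 = c - b\<^sup>2 / (4 * a)"
      using a by (simp add: power2_eq_square field_simps)
    with assms[of "- b / (2 * a)"] have "b\<^sup>2 / (4 * a) \<le> c" by simp
    with a show ?thesis by (simp add: field_simps)
  qed
qed

text \<open>
  Let \<open>f u = A + B u + C u\<^sup>2\<close> and \<open>g u = a + b u + c u\<^sup>2\<close>.  The hypothesis \<open>W\<close> says that the Wronskian
  \<open>f' g - f g' = \<gamma> + \<beta> u + \<alpha> u\<^sup>2\<close> is nonnegative on the real line.  Its coefficients satisfy the identity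
  \<open>A \<alpha> + C \<gamma> = B \<beta> / 2\<close>; inserted into the discriminant inequality \<open>\<beta>\<^sup>2 \<le> 4 \<alpha> \<gamma>\<close> it gives
  \<open>A \<beta> \<le> 2 B \<gamma>\<close>, that is, \<open>(g / f)'' \<ge> 0\<close> at \<open>0\<close>.  The conclusion compares
  \<open>g / f\<close> at \<open>0\<close> before and after the operation \<open>f \<mapsto> f \<delta> - C\<close>, \<open>g \<mapsto> g \<delta> - c\<close> and says that this
  ratio does not increase.
\<close>

lemma barrier_inequality:
  fixes A B C a b c \<delta> :: real
  assumes A: "A > 0" and B: "B \<ge> 0" and C: "C \<ge> 0"
    and W: "\<And>r. 0 \<le> (B * a - A * b) + 2 * (C * a - A * c) * r + (C * b - B * c) * r\<^sup>2"
    and \<delta>: "\<delta> \<ge> 0" "B \<le> \<delta> * A"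
  shows "(a + \<delta> * b + (\<delta>\<^sup>2 - 1) * c) * A \<le> a * (A + \<delta> * B + (\<delta>\<^sup>2 - 1) * C)"
proof -
  define \<gamma> \<beta> \<alpha> where "\<gamma> = B * a - A * b" and "\<beta> = 2 * (C * a - A * c)" and "\<alpha> = C * b - B * c"
  have disc: "\<beta>\<^sup>2 \<le> 4 * \<alpha> * \<gamma>" and \<gamma>: "0 \<le> \<gamma>"
    using quadratic_discriminant_le[of \<gamma> \<beta> \<alpha>] W by (auto simp: \<gamma>_def \<beta>_def \<alpha>_def)
  have rel: "A * \<alpha> = B * \<beta> / 2 - C * \<gamma>" by (simp add: \<gamma>_def \<beta>_def \<alpha>_def field_simps)
  have "A * \<beta>\<^sup>2 \<le> A * (4 * \<alpha> * \<gamma>)" using A disc by simp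
  also have "\<dots> = 4 * \<gamma> * (A * \<alpha>)" by simp
  also have "\<dots> = 2 * \<gamma> * B * \<beta> - 4 * C * \<gamma>\<^sup>2"
    unfolding rel by (simp add: power2_eq_square algebra_simps)
  also have "\<dots> \<le> 2 * \<gamma> * B * \<beta>" using C by simp
  finally have main: "A * \<beta>\<^sup>2 \<le> 2 * \<gamma> * B * \<beta>" .
  have \<beta>: "0 \<le> \<beta>"
  proof (rule ccontr)
    assume "\<not> 0 \<le> \<beta>"
    then have "A * \<beta>\<^sup>2 > 0" "2 * \<gamma> * B * \<beta> \<le> 0"
      using A B \<gamma> by (auto simp: mult_nonneg_nonpos)
    with main show False by simp
  qed
  have \<beta>_le: "\<beta> \<le> 2 * \<delta> * \<gamma>"
  proof (cases "\<beta> = 0")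
    case False
    with \<beta> have "\<beta> > 0" by simp
    with main have "A * \<beta> \<le> 2 * \<gamma> * B" by (simp add: power2_eq_square flip: mult.assoc)
    also have "\<dots> \<le> 2 * \<gamma> * (\<delta> * A)" using \<delta> \<gamma> by (intro mult_left_mono) auto
    also have "\<dots> = A * (2 * \<delta> * \<gamma>)" by simp
    finally show ?thesis using A by simp
  qed (use \<delta> \<gamma> in simp)
  have "0 \<le> \<delta>\<^sup>2 * \<beta>" using \<beta> by simp
  then have "0 \<le> (2 * \<delta> * \<gamma> - \<beta> + \<delta>\<^sup>2 * \<beta>) / 2" using \<beta>_le by simp
  also have "(2 * \<delta> * \<gamma> - \<beta> + \<delta>\<^sup>2 * \<beta>) / 2 = \<delta> * \<gamma> + (\<delta>\<^sup>2 - 1) * \<beta> / 2"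
    by (simp add: field_simps)
  also have "\<dots> = a * (A + \<delta> * B + (\<delta>\<^sup>2 - 1) * C) - (a + \<delta> * b + (\<delta>\<^sup>2 - 1) * c) * A"
    by (simp add: \<gamma>_def \<beta>_def field_simps)
  finally show ?thesis by simp
qed

text \<open>
  Up to the factor \<open>- Im z\<close>, the assumed expression is a real quadratic in \<open>Re z\<close> and \<open>Im z\<close> whose limit
  at the real line is the Wronskian of the two polynomials.
\<close>

lemma half_plane_wronskian:
  fixes A B C a b c r :: real
  assumes "\<And>z. Im z \<ge> 0 \<Longrightarrow> Im ((of_real a + of_real b * z + of_real c * z\<^sup>2) *
      cnj (of_real A + of_real B * z + of_real C * z\<^sup>2)) \<le> 0"
  shows "0 \<le> (B * a - A * b) + 2 * (C * a - A * c) * r + (C * b - B * c) * r\<^sup>2"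
proof -
  define W where "W \<eta> = (B * a - A * b) + 2 * (C * a - A * c) * r + (C * b - B * c) * (r\<^sup>2 + \<eta>\<^sup>2)" for \<eta>
  have "0 \<le> W \<eta>" if "\<eta> > 0" for \<eta>
  proof -
    have "Im ((of_real a + of_real b * Complex r \<eta> + of_real c * (Complex r \<eta>)\<^sup>2) *
      cnj (of_real A + of_real B * Complex r \<eta> + of_real C * (Complex r \<eta>)\<^sup>2)) = - \<eta> * W \<eta>"
      by (simp add: W_def power2_eq_square algebra_simps)
    with assms[of "Complex r \<eta>"] that have "0 \<le> \<eta> * W \<eta>" by simp
    with that show ?thesis by (simp add: zero_le_mult_iff)
  qed
  moreover have "(W \<longlongrightarrow> W 0) (at_right 0)" unfolding W_def by (intro tendsto_intros)
  ultimately have "0 \<le> W 0"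
    by (intro tendsto_lowerbound[of W "W 0" "at_right 0"]) (auto simp: eventually_at_right_less eventually_at_filter)
  then show ?thesis by (simp add: W_def)
qed

text \<open>
  All roots are real by the discriminant condition, hence negative.
\<close>

lemma nonneg_coeffs_of_positive_quadratic:
  fixes A B C :: real
  assumes A: "A > 0" and disc: "4 * A * C \<le> B\<^sup>2" and pos: "\<And>s. s \<ge> 0 \<Longrightarrow> A + B * s + C * s\<^sup>2 > 0"
  shows "B \<ge> 0" "C \<ge> 0"
proof -
  show B: "B \<ge> 0"
  proof (rule ccontr)
    assume "\<not> B \<ge> 0"
    then have B: "B < 0" by simp
    \<comment> \<open>Twice the argument at which the tangent at \<open>0\<close> vanishes.\<close>
    define s where "s = - 2 * A / B"
    have "s \<ge> 0" using A B by (simp add: s_def divide_nonneg_neg mult_nonneg_nonneg flip: minus_divide_left)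
    have "A + B * s + C * s\<^sup>2 = (A / B\<^sup>2) * (4 * A * C - B\<^sup>2)"
      using B by (simp add: s_def power2_eq_square field_simps)
    also have "\<dots> \<le> 0" using A B disc by (intro mult_nonneg_nonpos) auto
    finally show False using pos[OF \<open>s \<ge> 0\<close>] by simp
  qed
  show "C \<ge> 0"
  proof (rule ccontr)
    assume "\<not> C \<ge> 0"
    then have C: "C < 0" by simp
    define s where "s = (B + A) / (- C) + 1"
    have s: "s \<ge> 1" using A B C by (simp add: s_def divide_nonneg_neg divide_nonpos_neg)
    have "C * s = - B - A + C" using C by (simp add: s_def field_simps)
    have "A + B * s + C * s\<^sup>2 = A + s * (B + C * s)" by (simp add: power2_eq_square algebra_simps)
    also have "B + C * s = C - A" using \<open>C * s = - B - A + C\<close> by simp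
    also have "A + s * (C - A) = A - s * A + s * C" by (simp add: algebra_simps)
    finally have "A + B * s + C * s\<^sup>2 = A - s * A + s * C" .
    also have "\<dots> \<le> s * C" using s A by (simp add: mult_le_cancel_right1)
    also have "\<dots> \<le> 0" using s C by (simp add: mult_nonneg_nonpos)
    finally show False using pos[of s] s by simp
  qed
qed

context hyperbolic_polynomial
begin

text \<open>
  The logarithmic derivative of \<open>cmixed us\<close> in its first argument along \<open>v\<close> has nonpositive imaginary
  part: at a point of the tube, \<open>f + y g\<close> has no zero with \<open>Im y \<ge> 0\<close>, so that
  \<open>Im (- f / g) < 0\<close> unless \<open>g = 0\<close>.  The point \<open>Z\<close> may lie on the boundary of the tube and is
  approached along \<open>\<i> e\<close>.
\<close>

lemma cmixed_log_derivative:
  fixes w u v :: "real ^ 'm" and z :: complex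
  assumes us: "set us \<subseteq> rank_one_vecs" and u: "u \<in> cone" and v: "v \<in> rank_one_vecs"
    and z: "Im z \<ge> 0"
  defines "Z \<equiv> cvec w + z *s cvec u"
  shows "Im ((cmixed us (Z + cvec v) Z - cmixed us Z Z) * cnj (cmixed us Z Z)) \<le> 0"
proof -
  define Y where "Y \<epsilon> = Z + (\<i> * complex_of_real \<epsilon>) *s cvec e" for \<epsilon> :: real
  define F where "F \<epsilon> = Im ((cmixed us (Y \<epsilon> + cvec v) (Y \<epsilon>) - cmixed us (Y \<epsilon>) (Y \<epsilon>)) *
    cnj (cmixed us (Y \<epsilon>) (Y \<epsilon>)))" for \<epsilon>
  have "F \<epsilon> \<le> 0" if \<epsilon>: "\<epsilon> > 0" for \<epsilon>
  proof -
    have "cvec w + (\<i> * complex_of_real \<epsilon>) *s cvec e + z *s cvec u \<in> tube"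
      using \<epsilon> u z by (intro tube_add_cone tube_e) auto
    then have Y: "Y \<epsilon> \<in> tube" by (simp add: Y_def Z_def add_ac)
    define f g where "f = cmixed us (Y \<epsilon>) (Y \<epsilon>)" and "g = cmixed us (Y \<epsilon> + cvec v) (Y \<epsilon>) - f"
    have nz: "f + y * g \<noteq> 0" if "Im y \<ge> 0" for y
      using cmixed_nonzero[OF us tube_add_cone[OF Y rank_one_vecs_cone[OF v] that] Y]
      unfolding cmixed_affine_left[OF v] f_def g_def .
    show ?thesis
    proof (cases "g = 0")
      case False
      have "\<not> Im (- f / g) \<ge> 0" using nz[of "- f / g"] False by auto
      moreover have "Im (- f / g) = (Re f * Im g - Im f * Re g) / ((Re g)\<^sup>2 + (Im g)\<^sup>2)"
        unfolding Im_divide by simp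
      ultimately have "(Re f * Im g - Im f * Re g) / ((Re g)\<^sup>2 + (Im g)\<^sup>2) < 0" by linarith
      moreover have "(Re g)\<^sup>2 + (Im g)\<^sup>2 > 0" using False by (simp add: complex_neq_0)
      ultimately have "Re f * Im g - Im f * Re g < 0" by (simp add: divide_less_0_iff)
      then show ?thesis by (simp add: F_def flip: f_def g_def) (simp add: algebra_simps)
    qed (simp add: F_def flip: f_def g_def)
  qed
  moreover have "(F \<longlongrightarrow> F 0) (at_right 0)"
  proof -
    have "continuous_on {0..1} F"
      unfolding F_def Y_def by (intro continuous_intros continuous_cmixed)
    then show ?thesis by (rule continuous_on_Icc_at_rightD) simp
  qed
  ultimately have "F 0 \<le> 0"
    by (intro tendsto_upperbound[of F "F 0" "at_right 0"]) (auto simp: eventually_at_filter)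
  then show ?thesis by (simp add: F_def Y_def)
qed

text \<open>
  \<open>slope\<close> and \<open>curv\<close> are the linear and the quadratic coefficient of the quadratic polynomial
  \<open>s \<mapsto> rmixed us (w + s u) (w' + s u)\<close>.
\<close>

definition slope :: "(real ^ 'm) list \<Rightarrow> real ^ 'm \<Rightarrow> real ^ 'm \<Rightarrow> real ^ 'm \<Rightarrow> real" where
  "slope us u w w' = rmixed us (w + u) w' + rmixed us w (w' + u) - 2 * rmixed us w w'"

definition curv :: "(real ^ 'm) list \<Rightarrow> real ^ 'm \<Rightarrow> real ^ 'm \<Rightarrow> real ^ 'm \<Rightarrow> real" where
  "curv us u w w' = rmixed us (w + u) (w' + u) - rmixed us (w + u) w' - rmixed us w (w' + u) + rmixed us w w'"

lemma cmixed_diagonal: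
  assumes u: "u \<in> rank_one_vecs"
  shows "cmixed us (cvec w + z *s cvec u) (cvec w' + z *s cvec u) =
    of_real (rmixed us w w') + of_real (slope us u w w') * z + of_real (curv us u w w') * z\<^sup>2"
  unfolding cmixed_biaffine[OF u] slope_def curv_def
  by (simp only: cvec_simps(2)[symmetric] cmixed_cvec of_real_add of_real_diff of_real_mult of_real_numeral)
     (simp add: power2_eq_square algebra_simps)

lemma rmixed_diagonal:
  assumes u: "u \<in> rank_one_vecs"
  shows "rmixed us (w + s *\<^sub>R u) (w' + s *\<^sub>R u) =
    rmixed us w w' + slope us u w w' * s + curv us u w w' * s\<^sup>2"
  unfolding rmixed_biaffine[OF u] slope_def curv_def by (simp add: power2_eq_square algebra_simps)

text \<open>
  Averaging over the sign of \<open>u\<close> subtracts the quadratic coefficient \<open>curv\<close>.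
\<close>

lemma rmixed_Cons_diagonal:
  assumes u: "u \<in> rank_one_vecs"
  shows "rmixed (u # us) (w + s *\<^sub>R u) (w' + s *\<^sub>R u) =
    rmixed us w w' + s * slope us u w w' + (s\<^sup>2 - 1) * curv us u w w'"
proof -
  have "w + s *\<^sub>R u + u = w + (s + 1) *\<^sub>R u" "w' + s *\<^sub>R u - u = w' + (s - 1) *\<^sub>R u"
    "w + s *\<^sub>R u - u = w + (s - 1) *\<^sub>R u" "w' + s *\<^sub>R u + u = w' + (s + 1) *\<^sub>R u"
    by (simp_all add: algebra_simps)
  then show ?thesis
    by (simp only: mixed.simps rmixed_biaffine[OF u] slope_def curv_def)
       (simp add: power2_eq_square field_simps)
qed

text \<open>
  Applies to \<open>f s = rmixed us (w + s u) (w + s u)\<close> and \<open>g\<close>, the derivative along \<open>v\<close> in the first argument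
  at the same points.
\<close>

lemma rmixed_wronskian:
  fixes w u v :: "real ^ 'm"
  assumes us: "set us \<subseteq> rank_one_vecs" and u: "u \<in> rank_one_vecs" and v: "v \<in> rank_one_vecs"
  defines "A \<equiv> rmixed us w w" and "B \<equiv> slope us u w w" and "C \<equiv> curv us u w w"
  defines "a \<equiv> rmixed us (w + v) w - A" and "b \<equiv> slope us u (w + v) w - B"
    and "c \<equiv> curv us u (w + v) w - C"
  shows "0 \<le> (B * a - A * b) + 2 * (C * a - A * c) * r + (C * b - B * c) * r\<^sup>2"
proof (rule half_plane_wronskian)
  fix z assume z: "Im z \<ge> 0"
  let ?Z = "cvec w + z *s cvec u"
  have "cmixed us (?Z + cvec v) ?Z - cmixed us ?Z ?Z = of_real a + of_real b * z + of_real c * z\<^sup>2"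
    using cmixed_diagonal[OF u, of us "w + v" z w] cmixed_diagonal[OF u, of us w z w]
    by (simp add: a_def b_def c_def A_def B_def C_def algebra_simps)
  moreover have "cmixed us ?Z ?Z = of_real A + of_real B * z + of_real C * z\<^sup>2"
    unfolding A_def B_def C_def by (rule cmixed_diagonal[OF u])
  ultimately show "Im ((of_real a + of_real b * z + of_real c * z\<^sup>2) *
      cnj (of_real A + of_real B * z + of_real C * z\<^sup>2)) \<le> 0"
    using cmixed_log_derivative[OF us rank_one_vecs_cone[OF u] v z, of w] by simp
qed

text \<open>
  For \<open>v = u\<close> the polynomial \<open>g\<close> in the Wronskian is half of the derivative of \<open>f\<close>, and at the vertex
  of \<open>f\<close> the Wronskian is a quarter of \<open>B\<^sup>2 - 4 A C\<close>.
\<close>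

lemma rmixed_discriminant:
  assumes us: "set us \<subseteq> rank_one_vecs" and u: "u \<in> rank_one_vecs"
  shows "4 * rmixed us w w * curv us u w w \<le> (slope us u w w)\<^sup>2"
proof -
  define A B C where "A = rmixed us w w" and "B = slope us u w w" and "C = curv us u w w"
  have c: "rmixed us w (w + u) = rmixed us (w + u) w" by (rule mixed_commute)
  have a: "rmixed us (w + u) w - A = B / 2"
    unfolding A_def B_def slope_def c by simp
  have w2: "rmixed us (w + u + u) w = 2 * rmixed us (w + u) w - rmixed us w w"
    "rmixed us (w + u + u) (w + u) = 2 * rmixed us (w + u) (w + u) - rmixed us w (w + u)"
    using rmixed_biaffine[OF u, of us w 2 w 0] rmixed_biaffine[OF u, of us w 2 "w + u" 0]
    by (simp_all add: scaleR_2 add.assoc)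
  have b: "slope us u (w + u) w - B = C"
    unfolding B_def C_def slope_def curv_def w2 c by simp
  have c: "curv us u (w + u) w - C = 0"
    unfolding C_def curv_def w2 c by simp
  have W: "0 \<le> (B * (B / 2) - A * C) + 2 * (C * (B / 2) - A * 0) * r + (C * C - B * 0) * r\<^sup>2" for r
    using rmixed_wronskian[OF us u u, of w r] a b c
    unfolding A_def[symmetric] B_def[symmetric] C_def[symmetric] by simp
  show ?thesis
  proof (cases "C = 0")
    case False
    have "(B * (B / 2) - A * C) + 2 * (C * (B / 2) - A * 0) * (- B / (2 * C)) + (C * C - B * 0) * (- B / (2 * C))\<^sup>2
        = B\<^sup>2 / 4 - A * C" using False by (simp add: power2_eq_square field_simps)
    then show ?thesis using W[of "- B / (2 * C)"] by (simp add: A_def B_def C_def)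
  qed (simp add: C_def)
qed

text \<open>
  The points \<open>w0 + \<Sum>j. y\<^sub>j u\<^sub>j\<close> with \<open>y\<^sub>j \<ge> - \<delta>\<^sub>j\<close>.
\<close>

fun region :: "real ^ 'm \<Rightarrow> ((real ^ 'm) \<times> real) list \<Rightarrow> (real ^ 'm) set" where
  "region w0 [] = {w0}"
| "region w0 ((u, \<delta>) # rs) = {w + s *\<^sub>R u | w s. w \<in> region w0 rs \<and> s \<ge> - \<delta>}"

text \<open>
  The vectors \<open>us\<close> have been averaged out and those in \<open>rs\<close> are still to come.  The conditions are required
  on the whole region, not only at its lowest point: positivity above a point is what makes the
  coefficients \<open>slope\<close> and \<open>curv\<close> nonnegative there.
\<close>

definition barrier :: "(real ^ 'm) list \<Rightarrow> ((real ^ 'm) \<times> real) list \<Rightarrow> real ^ 'm \<Rightarrow> bool" where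
  "barrier us rs w0 \<longleftrightarrow> (\<forall>w\<in>region w0 rs. rmixed us w w > 0 \<and>
     (\<forall>(u, \<delta>)\<in>set rs. 2 * (rmixed us (w + u) w - rmixed us w w) \<le> \<delta> * rmixed us w w))"

text \<open>
  A point \<open>w\<close> of the smaller region is compared with \<open>w1 = w - \<delta> u\<close>, where the hypotheses hold with
  coefficients \<open>A, B, C\<close>.  The bound \<open>B \<le> \<delta> A\<close> and \<open>4 A C \<le> B\<^sup>2\<close> give \<open>C \<le> \<delta> B\<close>, hence the new value
  \<open>A + \<delta> B + (\<delta>\<^sup>2 - 1) C\<close> is positive, and \<open>barrier_inequality\<close> controls the other directions.
\<close>

lemma barrier_step:
  assumes us: "set us \<subseteq> rank_one_vecs" and u: "u \<in> rank_one_vecs" and \<delta>: "\<delta> \<ge> 0"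
    and rs: "fst ` set rs \<subseteq> rank_one_vecs"
    and bar: "barrier us ((u, \<delta>) # rs) w0"
  shows "barrier (u # us) rs w0"
  unfolding barrier_def
proof (intro ballI, intro conjI)
  fix w assume w: "w \<in> region w0 rs"
  define w1 where "w1 = w + (- \<delta>) *\<^sub>R u"
  have in_region: "w1 + s *\<^sub>R u \<in> region w0 ((u, \<delta>) # rs)" if "s \<ge> 0" for s
  proof -
    have "w1 + s *\<^sub>R u = w + (s - \<delta>) *\<^sub>R u" by (simp add: w1_def algebra_simps)
    then show ?thesis using w that by (auto intro!: exI[of _ w] exI[of _ "s - \<delta>"])
  qed
  define A B C where "A = rmixed us w1 w1" and "B = slope us u w1 w1" and "C = curv us u w1 w1"
  have A: "A > 0" and bu: "2 * (rmixed us (w1 + u) w1 - A) \<le> \<delta> * A"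
    and bv: "\<And>v \<eta>. (v, \<eta>) \<in> set rs \<Longrightarrow> 2 * (rmixed us (w1 + v) w1 - A) \<le> \<eta> * A"
    using bar in_region[of 0] unfolding barrier_def A_def by auto
  have pos: "A + B * s + C * s\<^sup>2 > 0" if "s \<ge> 0" for s
  proof -
    have "rmixed us (w1 + s *\<^sub>R u) (w1 + s *\<^sub>R u) > 0"
      using bar in_region[OF that] unfolding barrier_def by blast
    then show ?thesis by (simp add: rmixed_diagonal[OF u] A_def B_def C_def)
  qed
  have disc: "4 * A * C \<le> B\<^sup>2"
    using rmixed_discriminant[OF us u] by (simp add: A_def B_def C_def)
  note BC = nonneg_coeffs_of_positive_quadratic[OF A disc pos]
  have B\<delta>: "B \<le> \<delta> * A"
    using bu mixed_commute[of "mpoly_eval h" us w1 "w1 + u"] by (simp add: B_def slope_def A_def)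
  have w_eq: "w = w1 + \<delta> *\<^sub>R u" by (simp add: w1_def)
  have new: "rmixed (u # us) w w = A + \<delta> * B + (\<delta>\<^sup>2 - 1) * C"
    unfolding w_eq rmixed_Cons_diagonal[OF u] A_def B_def C_def by simp
  have "4 * A * C \<le> B * (\<delta> * A)"
    using disc mult_left_mono[OF B\<delta> BC(1)] by (simp add: power2_eq_square)
  then have "A * (4 * C) \<le> A * (\<delta> * B)" by (simp add: algebra_simps)
  then have "4 * C \<le> \<delta> * B" using A by simp
  moreover have "0 \<le> \<delta>\<^sup>2 * C" using BC by simp
  moreover have "A + \<delta> * B + (\<delta>\<^sup>2 - 1) * C = A + (\<delta> * B - C) + \<delta>\<^sup>2 * C" by (simp add: algebra_simps)
  ultimately show new_pos: "rmixed (u # us) w w > 0"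
    using A BC unfolding new by linarith
  show "\<forall>(v, \<eta>)\<in>set rs. 2 * (rmixed (u # us) (w + v) w - rmixed (u # us) w w) \<le> \<eta> * rmixed (u # us) w w"
  proof (intro ballI, clarify)
    fix v \<eta> assume v: "(v, \<eta>) \<in> set rs"
    then have v1: "v \<in> rank_one_vecs" using rs by force
    define a b c where "a = rmixed us (w1 + v) w1 - A" and "b = slope us u (w1 + v) w1 - B"
      and "c = curv us u (w1 + v) w1 - C"
    have "(w + v) = (w1 + v) + \<delta> *\<^sub>R u" by (simp add: w_eq)
    then have "rmixed (u # us) (w + v) w = rmixed (u # us) ((w1 + v) + \<delta> *\<^sub>R u) (w1 + \<delta> *\<^sub>R u)"
      by (simp only: w_eq)
    then have diff: "rmixed (u # us) (w + v) w - rmixed (u # us) w w = a + \<delta> * b + (\<delta>\<^sup>2 - 1) * c"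
      unfolding new rmixed_Cons_diagonal[OF u] a_def b_def c_def by (simp add: algebra_simps)
    have "(a + \<delta> * b + (\<delta>\<^sup>2 - 1) * c) * A \<le> a * (A + \<delta> * B + (\<delta>\<^sup>2 - 1) * C)"
    proof (rule barrier_inequality[OF A BC _ \<delta> B\<delta>])
      show "0 \<le> (B * a - A * b) + 2 * (C * a - A * c) * r + (C * b - B * c) * r\<^sup>2" for r
        unfolding A_def B_def C_def a_def b_def c_def by (rule rmixed_wronskian[OF us u v1])
    qed
    then have "A * (2 * (rmixed (u # us) (w + v) w - rmixed (u # us) w w)) \<le> 2 * a * rmixed (u # us) w w"
      unfolding diff unfolding new by (simp add: algebra_simps)
    also have "\<dots> \<le> \<eta> * A * rmixed (u # us) w w"
      using bv[OF v] new_pos by (intro mult_right_mono) (auto simp: a_def)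
    also have "\<eta> * A * rmixed (u # us) w w = A * (\<eta> * rmixed (u # us) w w)"
      by (simp only: mult_ac)
    finally show "2 * (rmixed (u # us) (w + v) w - rmixed (u # us) w w) \<le> \<eta> * rmixed (u # us) w w"
      by (simp only: mult_le_cancel_left_pos[OF A])
  qed
qed

lemma barrier_finish:
  assumes "set us \<subseteq> rank_one_vecs" "fst ` set rs \<subseteq> rank_one_vecs" "\<forall>\<delta>\<in>snd ` set rs. \<delta> \<ge> 0"
    "barrier us rs w0"
  shows "rmixed (rev (map fst rs) @ us) w0 w0 > 0"
  using assms
proof (induction rs arbitrary: us)
  case Nil
  then show ?case by (simp add: barrier_def)
next
  case (Cons r rs)
  obtain u \<delta> where r: "r = (u, \<delta>)" by fastforce
  have "barrier (u # us) rs w0" using Cons.prems unfolding r by (intro barrier_step[of us u \<delta>]) auto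
  with Cons.IH[of "u # us"] Cons.prems show ?case by (simp add: r)
qed

lemma region_above:
  assumes "fst ` set rs \<subseteq> cone" "w \<in> region w0 rs"
  shows "w - w0 + (\<Sum>(u, \<delta>)\<leftarrow>rs. \<delta> *\<^sub>R u) \<in> cone"
  using assms
proof (induction rs arbitrary: w)
  case (Cons r rs)
  obtain u \<delta> where r: "r = (u, \<delta>)" by fastforce
  with Cons.prems obtain w' s where w: "w = w' + s *\<^sub>R u" "w' \<in> region w0 rs" "s \<ge> - \<delta>" by auto
  have "(w' - w0 + (\<Sum>(u, \<delta>)\<leftarrow>rs. \<delta> *\<^sub>R u)) + (s + \<delta>) *\<^sub>R u \<in> cone"
    using Cons.prems(1) w(3) r by (intro cone_add[OF Cons.IH[OF _ w(2)]] cone_scale) auto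
  then show ?case unfolding r w(1) by (simp add: algebra_simps)
qed simp

text \<open>
  The point \<open>w\<close> is at least \<open>l e\<close>, and \<open>T e\<close> is at least \<open>u\<close>.  So \<open>h (w - s u) > 0\<close> while \<open>s T < l\<close>.  This
  function of \<open>s\<close> is affine, which bounds its slope by \<open>T h w / l\<close>.
\<close>

lemma barrier_init:
  assumes rs: "\<And>u \<delta>. (u, \<delta>) \<in> set rs \<Longrightarrow> \<exists>T. rank_one T u \<and> 2 * T \<le> \<delta> * l"
    and l: "l > 0" and above: "w0 - (\<Sum>(u, \<delta>)\<leftarrow>rs. \<delta> *\<^sub>R u) - l *\<^sub>R e \<in> cone"
  shows "barrier [] rs w0"
  unfolding barrier_def
proof (intro ballI, intro conjI)
  fix w assume w: "w \<in> region w0 rs"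
  have "fst ` set rs \<subseteq> cone" using rs by (force simp: rank_one_def)
  from cone_add[OF region_above[OF this w] above] have c: "w - l *\<^sub>R e \<in> cone" by simp
  from cone_pos[OF this l] have hw: "mpoly_eval h w > 0" by simp
  then show "rmixed [] w w > 0" by simp
  show "\<forall>(u, \<delta>)\<in>set rs. 2 * (rmixed [] (w + u) w - rmixed [] w w) \<le> \<delta> * rmixed [] w w"
  proof (intro ballI, clarify)
    fix u \<delta> assume "(u, \<delta>) \<in> set rs"
    then obtain T where T: "rank_one T u" "2 * T \<le> \<delta> * l" using rs by blast
    define D where "D = mpoly_eval h (w + u) - mpoly_eval h w"
    have "l * D \<le> T * mpoly_eval h w"
    proof (rule ccontr)
      assume neg: "\<not> l * D \<le> T * mpoly_eval h w"
      have T0: "T \<ge> 0" "T *\<^sub>R e - u \<in> cone" using T(1) by (auto simp: rank_one_def)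
      have "0 \<le> T * mpoly_eval h w" using T0 hw by simp
      with neg have "l * D > 0" by linarith
      then have D: "D > 0" using l by (simp add: zero_less_mult_iff)
      \<comment> \<open>At this \<open>s\<close> the affine function \<open>h (w - s u) = h w - s D\<close> vanishes.\<close>
      define s where "s = mpoly_eval h w / D"
      have s: "s \<ge> 0" "s * T < l" using neg D hw by (auto simp: s_def field_simps)
      have "w - l *\<^sub>R e + s *\<^sub>R (T *\<^sub>R e - u) \<in> cone" using c T0 s by (intro cone_add cone_scale)
      from cone_pos[OF this, of "l - s * T"] s
      have "mpoly_eval h (w + (- s) *\<^sub>R u) > 0" by (simp add: algebra_simps)
      also have "mpoly_eval h (w + (- s) *\<^sub>R u) = 0"
        unfolding rank_one_affine_real[OF T(1)] using D by (simp add: s_def D_def)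
      finally show False by simp
    qed
    then have "l * (2 * D) \<le> 2 * T * mpoly_eval h w" by simp
    also have "\<dots> \<le> \<delta> * l * mpoly_eval h w" using T(2) hw by (intro mult_right_mono) auto
    finally have "l * (2 * D) \<le> l * (\<delta> * mpoly_eval h w)" by (simp add: algebra_simps)
    then have "2 * D \<le> \<delta> * mpoly_eval h w" using l by simp
    then have "2 * D * mpoly_eval h w \<le> \<delta> * mpoly_eval h w * mpoly_eval h w"
      using hw by (intro mult_right_mono) auto
    then show "2 * (rmixed [] (w + u) w - rmixed [] w w) \<le> \<delta> * rmixed [] w w"
      by (simp add: D_def algebra_simps)
  qed
qed

lemma rmixed_pos_of_barrier:
  assumes T: "\<And>i. i \<in> set is \<Longrightarrow> rank_one (T i) (u i)"
    and c: "c > 0" "2 \<le> c * l"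
    and above: "w0 - (\<Sum>i\<leftarrow>is. (c * T i) *\<^sub>R u i) - l *\<^sub>R e \<in> cone"
  shows "rmixed (map u is) w0 w0 > 0"
proof -
  define rs where "rs = map (\<lambda>i. (u i, c * T i)) (rev is)"
  have "c * l > 0" using c by linarith
  then have l: "l > 0" using c(1) by (simp add: zero_less_mult_iff)
  have T0: "T i \<ge> 0" "u i \<in> rank_one_vecs" if "i \<in> set is" for i
    using T[OF that] by (auto simp: rank_one_def rank_one_vecs_def)
  have "barrier [] rs w0"
  proof (rule barrier_init[OF _ l])
    show "\<exists>T. rank_one T v \<and> 2 * T \<le> \<delta> * l" if v: "(v, \<delta>) \<in> set rs" for v \<delta>
    proof -
      obtain i where i: "i \<in> set is" "v = u i" "\<delta> = c * T i" using v by (auto simp: rs_def)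
      have "2 * T i \<le> (c * l) * T i" using c T0[OF i(1)] by (intro mult_right_mono) auto
      then show ?thesis using T[OF i(1)] i by (intro exI[of _ "T i"]) (simp add: algebra_simps)
    qed
    have "(\<Sum>(u, \<delta>)\<leftarrow>rs. \<delta> *\<^sub>R u) = (\<Sum>i\<leftarrow>is. (c * T i) *\<^sub>R u i)"
      by (simp add: rs_def sum_list_rev o_def flip: rev_map)
    then show "w0 - (\<Sum>(u, \<delta>)\<leftarrow>rs. \<delta> *\<^sub>R u) - l *\<^sub>R e \<in> cone" using above by simp
  qed
  then have "rmixed (rev (map fst rs) @ []) w0 w0 > 0"
    using T0 c by (intro barrier_finish) (auto simp: rs_def)
  then show ?thesis by (simp add: rs_def o_def flip: rev_map)
qed

end

section \<open>Selecting the outcomes one at a time\<close>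

context hyperbolic_polynomial
begin

text \<open>
  All the averaged products have the same coefficient \<open>(h e)\<^sup>2\<close> in degree \<open>2 d\<close>, so nothing cancels.
\<close>

lemma rmixed_poly:
  obtains p where "\<And>x. poly p x = rmixed us (x *\<^sub>R e + Y) (x *\<^sub>R e + Y')"
    "\<And>z. poly (map_poly complex_of_real p) z = cmixed us (z *s cvec e + cvec Y) (z *s cvec e + cvec Y')"
    "lead_coeff p > 0"
proof -
  have "\<exists>p. (\<forall>x. poly p x = rmixed us (x *\<^sub>R e + Y) (x *\<^sub>R e + Y')) \<and>
    (\<forall>z. poly (map_poly complex_of_real p) z = cmixed us (z *s cvec e + cvec Y) (z *s cvec e + cvec Y')) \<and>
    degree p \<le> d + d \<and> coeff p (d + d) = (mpoly_eval h e)\<^sup>2"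
  proof (induction us arbitrary: Y Y')
    case Nil
    let ?p = "hyp_charpoly h e (- Y) * hyp_charpoly h e (- Y')"
    have "degree ?p \<le> d + d"
      using degree_mult_le[of "hyp_charpoly h e (- Y)" "hyp_charpoly h e (- Y')"]
        hyp_charpoly_top(1)[OF hom, of e "- Y"] hyp_charpoly_top(1)[OF hom, of e "- Y'"] by linarith
    moreover have "coeff ?p (d + d) = (mpoly_eval h e)\<^sup>2"
      by (simp add: coeff_mult_top hyp_charpoly_top[OF hom] power2_eq_square)
    ultimately show ?case
      by (intro exI[of _ ?p]) (simp add: poly_hyp_charpoly map_of_real_mult map_poly_hyp_charpoly)
  next
    case (Cons u us)
    obtain p where p: "\<And>x. poly p x = rmixed us (x *\<^sub>R e + (Y + u)) (x *\<^sub>R e + (Y' - u))"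
      "\<And>z. poly (map_poly complex_of_real p) z =
        cmixed us (z *s cvec e + cvec (Y + u)) (z *s cvec e + cvec (Y' - u))"
      "degree p \<le> d + d" "coeff p (d + d) = (mpoly_eval h e)\<^sup>2"
      using Cons.IH[of "Y + u" "Y' - u"] by blast
    obtain q where q: "\<And>x. poly q x = rmixed us (x *\<^sub>R e + (Y - u)) (x *\<^sub>R e + (Y' + u))"
      "\<And>z. poly (map_poly complex_of_real q) z =
        cmixed us (z *s cvec e + cvec (Y - u)) (z *s cvec e + cvec (Y' + u))"
      "degree q \<le> d + d" "coeff q (d + d) = (mpoly_eval h e)\<^sup>2"
      using Cons.IH[of "Y - u" "Y' + u"] by blast
    have "degree (smult (1 / 2) (p + q)) \<le> d + d"
      using p(3) q(3) by (simp add: degree_add_le)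
    then show ?case
      using p(4) q(4)
      by (intro exI[of _ "smult (1 / 2) (p + q)"])
         (simp add: p(1,2) q(1,2) map_of_real_smult map_of_real_add add_diff_eq add.assoc)
  qed
  then obtain p where p: "\<And>x. poly p x = rmixed us (x *\<^sub>R e + Y) (x *\<^sub>R e + Y')"
    "\<And>z. poly (map_poly complex_of_real p) z = cmixed us (z *s cvec e + cvec Y) (z *s cvec e + cvec Y')"
    "degree p \<le> d + d" "coeff p (d + d) = (mpoly_eval h e)\<^sup>2"
    by blast
  have "lead_coeff p > 0"
    using p(3,4) h_e_pos le_degree[of p "d + d"] by force
  with p(1,2) show ?thesis by (rule that)
qed

lemma rmixed_real_rooted:
  assumes us: "set us \<subseteq> rank_one_vecs"
    and p: "\<And>z. poly (map_poly complex_of_real p) z =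
      cmixed us (z *s cvec e + cvec Y) (z *s cvec e + cvec Y')"
  shows "real_rooted p"
proof -
  let ?P = "map_poly complex_of_real p"
  have upper: "poly ?P z \<noteq> 0" if "Im z > 0" for z
    using cmixed_nonzero[OF us tube_e[OF that, of Y] tube_e[OF that, of Y']]
    by (simp add: p add.commute)
  show ?thesis
    unfolding real_rooted_def
  proof (intro allI impI, rule ccontr)
    fix z assume z: "poly ?P z = 0" "z \<notin> \<real>"
    have "poly ?P (cnj z) = cnj (poly ?P z)"
      by (rule poly_cnj_real[symmetric]) (simp add: coeff_map_poly)
    with z(1) have "poly ?P (cnj z) = 0" by simp
    moreover have "Im z > 0 \<or> Im (cnj z) > 0" using z(2) by (auto simp: complex_is_Real_iff)
    ultimately show False using upper z(1) by metis
  qed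
qed

text \<open>
  Let \<open>Q x s\<close> be the polynomial for the outcome \<open>s\<close>.  It is quadratic in \<open>s\<close>, so the sign average with
  scale \<open>\<tau>\<close> is the mean of \<open>Q x s\<close> over the distribution.  If every outcome of positive probability were
  bad at some point beyond \<open>x0\<close>, let \<open>x1\<close> be the leftmost of these points.  The mean is positive at
  \<open>x1\<close>, so some outcome is still good there; by \<open>real_rooted_segment_pos\<close> it stays good to the right, a
  contradiction.
\<close>

lemma rmixed_selection:
  assumes us: "set us \<subseteq> rank_one_vecs" and v: "v \<in> rank_one_vecs" and \<tau>: "\<tau> \<ge> 0"
    and S: "finite S" "\<And>s. s \<in> S \<Longrightarrow> p s \<ge> 0" "(\<Sum>s\<in>S. p s) = 1" "(\<Sum>s\<in>S. p s * s) = 0"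
      "(\<Sum>s\<in>S. p s * s\<^sup>2) = \<tau>\<^sup>2"
    and pos: "\<And>x. x > x0 \<Longrightarrow> rmixed ((\<tau> *\<^sub>R v) # us) (x *\<^sub>R e + Y) (x *\<^sub>R e - Y) > 0"
  obtains s where "s \<in> S" "p s > 0"
    "\<And>x. x > x0 \<Longrightarrow> rmixed us (x *\<^sub>R e + (Y + s *\<^sub>R v)) (x *\<^sub>R e - (Y + s *\<^sub>R v)) > 0"
proof -
  define Q where "Q x s = rmixed us (x *\<^sub>R e + (Y + s *\<^sub>R v)) (x *\<^sub>R e - (Y + s *\<^sub>R v))" for x s
  define G where "G r m x = rmixed ((r *\<^sub>R v) # us) (x *\<^sub>R e + (Y + m *\<^sub>R v)) (x *\<^sub>R e - (Y + m *\<^sub>R v))" for r m x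
  define a where "a x = Q x 0" for x
  define b where "b x = (rmixed us (x *\<^sub>R e + Y + v) (x *\<^sub>R e - Y) - rmixed us (x *\<^sub>R e + Y) (x *\<^sub>R e - Y)) -
      (rmixed us (x *\<^sub>R e + Y) (x *\<^sub>R e - Y + v) - rmixed us (x *\<^sub>R e + Y) (x *\<^sub>R e - Y))" for x
  define c where "c x = curv us v (x *\<^sub>R e + Y) (x *\<^sub>R e - Y)" for x
  have Q: "Q x s = a x + s * b x - s\<^sup>2 * c x" for x s
  proof -
    have "Q x s = rmixed us ((x *\<^sub>R e + Y) + s *\<^sub>R v) ((x *\<^sub>R e - Y) + (- s) *\<^sub>R v)"
      by (simp add: Q_def algebra_simps)
    also have "\<dots> = a x + s * b x - s\<^sup>2 * c x"
      unfolding rmixed_biaffine[OF v] by (simp add: a_def b_def c_def Q_def curv_def power2_eq_square algebra_simps)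
    finally show ?thesis .
  qed
  have G: "G r m x = a x + m * b x - (m\<^sup>2 + r\<^sup>2) * c x" for r m x
  proof -
    have "G r m x = (Q x (m + r) + Q x (m - r)) / 2"
      by (simp add: G_def Q_def algebra_simps)
    then show ?thesis by (simp add: Q power2_eq_square field_simps)
  qed
  have mean: "G \<tau> 0 x = (\<Sum>s\<in>S. p s * Q x s)" for x
  proof -
    have "(\<Sum>s\<in>S. p s * Q x s) = (\<Sum>s\<in>S. p s) * a x + (\<Sum>s\<in>S. p s * s) * b x - (\<Sum>s\<in>S. p s * s\<^sup>2) * c x"
      unfolding Q sum_distrib_right sum.distrib[symmetric] sum_subtractf[symmetric]
      by (intro sum.cong) (auto simp: algebra_simps)
    then show ?thesis by (simp add: S G)
  qed
  have Gpos: "G \<tau> 0 x > 0" if "x > x0" for x using pos[OF that] by (simp add: G_def)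
  have persist: "Q y s > 0" if s: "Q x s > 0" "x > x0" "x \<le> y" for x y s
  proof -
    obtain f where f: "\<And>x. poly f x = rmixed us (x *\<^sub>R e + (Y + s *\<^sub>R v)) (x *\<^sub>R e + - (Y + s *\<^sub>R v))"
      "\<And>z. poly (map_poly complex_of_real f) z = cmixed us
        (z *s cvec e + cvec (Y + s *\<^sub>R v)) (z *s cvec e + cvec (- (Y + s *\<^sub>R v)))"
      "lead_coeff f > 0" by (rule rmixed_poly[of us "Y + s *\<^sub>R v" "- (Y + s *\<^sub>R v)"]) (rule that)
    obtain g where g: "\<And>x. poly g x = rmixed ((\<tau> *\<^sub>R v) # us) (x *\<^sub>R e + (Y + 0 *\<^sub>R v)) (x *\<^sub>R e + - (Y + 0 *\<^sub>R v))"
      "\<And>z. poly (map_poly complex_of_real g) z = cmixed ((\<tau> *\<^sub>R v) # us)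
        (z *s cvec e + cvec (Y + 0 *\<^sub>R v)) (z *s cvec e + cvec (- (Y + 0 *\<^sub>R v)))"
      "lead_coeff g > 0" by (rule rmixed_poly[of "(\<tau> *\<^sub>R v) # us" "Y + 0 *\<^sub>R v" "- (Y + 0 *\<^sub>R v)"]) (rule that)
    have fQ: "poly f x = Q x s" for x unfolding f(1) Q_def by (simp only: diff_conv_add_uminus)
    have gG: "poly g x = G \<tau> 0 x" for x unfolding g(1) G_def by (simp only: diff_conv_add_uminus)
    have "poly f y > 0"
    proof (rule real_rooted_segment_pos[OF _ f(3) g(3) _ _ \<open>x \<le> y\<close>])
      show "real_rooted (smult (1 - t) f + smult t g)" if t: "0 \<le> t" "t \<le> 1" for t
      proof -
        \<comment> \<open>The mixture of the point mass at \<open>s\<close> and the given distribution has mean \<open>m\<close> and variance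
          \<open>r\<^sup>2\<close>, and only these two numbers enter.\<close>
        define m where "m = (1 - t) * s"
        define r where "r = sqrt ((1 - t) * t * s\<^sup>2 + t * \<tau>\<^sup>2)"
        have r2: "r\<^sup>2 = (1 - t) * t * s\<^sup>2 + t * \<tau>\<^sup>2" and r: "r \<ge> 0" using t by (auto simp: r_def)
        obtain k where k: "\<And>x. poly k x = rmixed ((r *\<^sub>R v) # us) (x *\<^sub>R e + (Y + m *\<^sub>R v)) (x *\<^sub>R e + - (Y + m *\<^sub>R v))"
          "\<And>z. poly (map_poly complex_of_real k) z = cmixed ((r *\<^sub>R v) # us)
            (z *s cvec e + cvec (Y + m *\<^sub>R v)) (z *s cvec e + cvec (- (Y + m *\<^sub>R v)))"
          "lead_coeff k > 0"
          by (rule rmixed_poly[of "(r *\<^sub>R v) # us" "Y + m *\<^sub>R v" "- (Y + m *\<^sub>R v)"]) (rule that)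
        have "real_rooted k"
          by (rule rmixed_real_rooted[OF _ k(2)]) (use us v r rank_one_vecs_scale in auto)
        moreover have "smult (1 - t) f + smult t g = k"
        proof (rule poly_ext)
          fix x
          have "poly k x = G r m x" unfolding k(1) G_def by (simp only: diff_conv_add_uminus)
          then have "poly k x = a x + m * b x - (m\<^sup>2 + ((1 - t) * t * s\<^sup>2 + t * \<tau>\<^sup>2)) * c x"
            by (simp only: G r2)
          then show "poly (smult (1 - t) f + smult t g) x = poly k x"
            by (simp add: fQ gG Q G m_def power2_eq_square algebra_simps)
        qed
        ultimately show ?thesis by simp
      qed
    qed (use s Gpos in \<open>auto simp: fQ gG\<close>)
    then show ?thesis by (simp add: fQ)
  qed
  define S' where "S' = {s \<in> S. p s > 0}"
  have S': "finite S'" "S' \<noteq> {}"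
  proof -
    show "finite S'" using S(1) by (simp add: S'_def)
    show "S' \<noteq> {}"
    proof
      assume "S' = {}"
      then have "(\<Sum>s\<in>S. p s) = 0" using S(2) by (intro sum.neutral) (force simp: S'_def)
      then show False using S(3) by simp
    qed
  qed
  have "\<exists>s\<in>S'. \<forall>x>x0. Q x s > 0"
  proof (rule ccontr)
    assume "\<not> ?thesis"
    then have "\<forall>s\<in>S'. \<exists>x>x0. Q x s \<le> 0" by (meson not_le)
    then obtain X where X: "\<And>s. s \<in> S' \<Longrightarrow> X s > x0 \<and> Q (X s) s \<le> 0" by metis
    define x1 where "x1 = Min (X ` S')"
    have x1: "x1 > x0" "\<And>s. s \<in> S' \<Longrightarrow> x1 \<le> X s" using S' X by (auto simp: x1_def)
    have "p s * Q x1 s \<le> 0" if "s \<in> S" for s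
    proof (cases "p s > 0")
      case True
      then have s: "s \<in> S'" using that by (simp add: S'_def)
      have "Q x1 s \<le> 0"
        using persist[of x1 s "X s"] x1 X[OF s] s by (meson not_le)
      then show ?thesis using True by (simp add: mult_nonneg_nonpos)
    qed (use S(2)[OF that] in auto)
    then have "G \<tau> 0 x1 \<le> 0" unfolding mean by (intro sum_nonpos) auto
    with Gpos[OF x1(1)] show False by simp
  qed
  then show ?thesis using that by (auto simp: S'_def Q_def)
qed

lemma rmixed_select_all:
  assumes "\<And>i. i \<in> set is \<Longrightarrow> v i \<in> rank_one_vecs" "\<And>i. i \<in> set is \<Longrightarrow> \<tau> i \<ge> 0"
    and "\<And>i. i \<in> set is \<Longrightarrow> finite (S i)" "\<And>i s. i \<in> set is \<Longrightarrow> s \<in> S i \<Longrightarrow> p i s \<ge> 0"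
      "\<And>i. i \<in> set is \<Longrightarrow> (\<Sum>s\<in>S i. p i s) = 1" "\<And>i. i \<in> set is \<Longrightarrow> (\<Sum>s\<in>S i. p i s * s) = 0"
      "\<And>i. i \<in> set is \<Longrightarrow> (\<Sum>s\<in>S i. p i s * s\<^sup>2) = (\<tau> i)\<^sup>2"
    and "distinct is"
    and "\<And>x. x > x0 \<Longrightarrow> rmixed (map (\<lambda>i. \<tau> i *\<^sub>R v i) is) (x *\<^sub>R e + Y) (x *\<^sub>R e - Y) > 0"
  shows "\<exists>s. (\<forall>i\<in>set is. s i \<in> S i \<and> p i (s i) > 0) \<and>
    (\<forall>x>x0. rmixed [] (x *\<^sub>R e + (Y + (\<Sum>i\<in>set is. s i *\<^sub>R v i))) (x *\<^sub>R e - (Y + (\<Sum>i\<in>set is. s i *\<^sub>R v i))) > 0)"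
  using assms
proof (induction "is" arbitrary: Y)
  case Nil
  then show ?case by simp
next
  case (Cons j js)
  obtain t where t: "t \<in> S j" "p j t > 0"
    "\<And>x. x > x0 \<Longrightarrow> rmixed (map (\<lambda>i. \<tau> i *\<^sub>R v i) js) (x *\<^sub>R e + (Y + t *\<^sub>R v j)) (x *\<^sub>R e - (Y + t *\<^sub>R v j)) > 0"
  proof (rule rmixed_selection[of "map (\<lambda>i. \<tau> i *\<^sub>R v i) js" "v j" "\<tau> j" "S j" "p j" x0 Y])
    show "set (map (\<lambda>i. \<tau> i *\<^sub>R v i) js) \<subseteq> rank_one_vecs"
      using Cons.prems(1,2) rank_one_vecs_scale by auto
  qed (use Cons.prems in auto)
  obtain s where s: "\<forall>i\<in>set js. s i \<in> S i \<and> p i (s i) > 0"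
    "\<forall>x>x0. rmixed [] (x *\<^sub>R e + (Y + t *\<^sub>R v j + (\<Sum>i\<in>set js. s i *\<^sub>R v i)))
      (x *\<^sub>R e - (Y + t *\<^sub>R v j + (\<Sum>i\<in>set js. s i *\<^sub>R v i))) > 0"
    using Cons.IH[OF _ _ _ _ _ _ _ _ t(3)] Cons.prems by auto
  have j: "j \<notin> set js" using Cons.prems by simp
  have "(\<Sum>i\<in>set (j # js). (s(j := t)) i *\<^sub>R v i) = t *\<^sub>R v j + (\<Sum>i\<in>set js. s i *\<^sub>R v i)"
  proof -
    have "(\<Sum>i\<in>set js. (s(j := t)) i *\<^sub>R v i) = (\<Sum>i\<in>set js. s i *\<^sub>R v i)"
      using j by (intro sum.cong) auto
    then show ?thesis using j by simp
  qed
  then have "\<forall>x>x0. rmixed [] (x *\<^sub>R e + (Y + (\<Sum>i\<in>set (j # js). (s(j := t)) i *\<^sub>R v i)))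
      (x *\<^sub>R e - (Y + (\<Sum>i\<in>set (j # js). (s(j := t)) i *\<^sub>R v i))) > 0"
    using s(2) by (simp add: add.assoc)
  moreover have "\<forall>i\<in>set (j # js). (s(j := t)) i \<in> S i \<and> p i ((s(j := t)) i) > 0"
    using s(1) t j by auto
  ultimately show ?case by blast
qed

text \<open>
  Here the scales are fixed: for \<open>x > 4 \<sigma>\<close> the barrier argument is run with \<open>c = 4 / x\<close> and \<open>l = x / 2\<close>.
\<close>

lemma exists_outcome_with_small_norm:
  fixes v :: "nat \<Rightarrow> real ^ 'm" and T \<tau> :: "nat \<Rightarrow> real"
  assumes d: "d > 0" and I: "finite I" and v: "\<And>i. i \<in> I \<Longrightarrow> rank_one (T i) (v i)"
    and \<tau>: "\<And>i. i \<in> I \<Longrightarrow> \<tau> i \<ge> 0"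
    and S: "\<And>i. i \<in> I \<Longrightarrow> finite (S i)" "\<And>i s. i \<in> I \<Longrightarrow> s \<in> S i \<Longrightarrow> p i s \<ge> 0"
      "\<And>i. i \<in> I \<Longrightarrow> (\<Sum>s\<in>S i. p i s) = 1" "\<And>i. i \<in> I \<Longrightarrow> (\<Sum>s\<in>S i. p i s * s) = 0"
      "\<And>i. i \<in> I \<Longrightarrow> (\<Sum>s\<in>S i. p i s * s\<^sup>2) = (\<tau> i)\<^sup>2"
    and \<sigma>: "\<sigma> \<ge> 0" "hyp_norm d h e (\<Sum>i\<in>I. ((\<tau> i)\<^sup>2 * T i) *\<^sub>R v i) \<le> \<sigma>\<^sup>2"
  obtains s where "\<And>i. i \<in> I \<Longrightarrow> s i \<in> S i \<and> p i (s i) > 0"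
    "hyp_norm d h e (\<Sum>i\<in>I. s i *\<^sub>R v i) \<le> 4 * \<sigma>"
proof -
  obtain js where js: "set js = I" "distinct js" using I finite_distinct_list by blast
  define W where "W = (\<Sum>i\<in>I. ((\<tau> i)\<^sup>2 * T i) *\<^sub>R v i)"
  have W: "\<sigma>\<^sup>2 *\<^sub>R e - W \<in> cone"
    using \<sigma>(2) hyp_norm_le_iff_cone[OF d, of "\<sigma>\<^sup>2" W] by (simp add: W_def)
  have pos: "rmixed (map (\<lambda>i. \<tau> i *\<^sub>R v i) js) (x *\<^sub>R e + 0) (x *\<^sub>R e - 0) > 0" if x: "x > 4 * \<sigma>" for x
  proof -
    have x0: "x > 0" using x \<sigma>(1) by linarith
    define c l where "c = 4 / x" and "l = x / 2"
    have c: "c > 0" using x0 by (simp add: c_def)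
    have eq: "(\<Sum>i\<leftarrow>js. (c * (\<tau> i * T i)) *\<^sub>R (\<tau> i *\<^sub>R v i)) = c *\<^sub>R W"
      unfolding W_def scaleR_sum_right js(1)[symmetric] sum_list_distinct_conv_sum_set[OF js(2)]
      by (intro sum.cong) (auto simp: power2_eq_square algebra_simps)
    have "rmixed (map (\<lambda>i. \<tau> i *\<^sub>R v i) js) (x *\<^sub>R e) (x *\<^sub>R e) > 0"
    proof (rule rmixed_pos_of_barrier[where T = "\<lambda>i. \<tau> i * T i" and c = c and l = l])
      show "rank_one (\<tau> i * T i) (\<tau> i *\<^sub>R v i)" if "i \<in> set js" for i
        using that js v \<tau> by (intro rank_one_scale) auto
      show "2 \<le> c * l" using x0 by (simp add: c_def l_def)
      have "(4 * \<sigma>)\<^sup>2 \<le> x\<^sup>2" using x \<sigma>(1) by (intro power_mono) auto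
      then have "c * \<sigma>\<^sup>2 \<le> x / 4" using x0 by (simp add: c_def power2_eq_square field_simps)
      then have nn: "x - l - c * \<sigma>\<^sup>2 \<ge> 0" using x0 by (simp add: l_def)
      have "c *\<^sub>R (\<sigma>\<^sup>2 *\<^sub>R e - W) + (x - l - c * \<sigma>\<^sup>2) *\<^sub>R e \<in> cone"
        using W c nn by (intro cone_add cone_scale cone_e) auto
      moreover have "c *\<^sub>R (\<sigma>\<^sup>2 *\<^sub>R e - W) + (x - l - c * \<sigma>\<^sup>2) *\<^sub>R e = x *\<^sub>R e - c *\<^sub>R W - l *\<^sub>R e"
        by (simp add: algebra_simps)
      ultimately show "x *\<^sub>R e - (\<Sum>i\<leftarrow>js. (c * (\<tau> i * T i)) *\<^sub>R (\<tau> i *\<^sub>R v i)) - l *\<^sub>R e \<in> cone"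
        unfolding eq by metis
    qed (rule c)
    then show ?thesis by simp
  qed
  have "\<exists>s. (\<forall>i\<in>set js. s i \<in> S i \<and> p i (s i) > 0) \<and>
    (\<forall>x>4 * \<sigma>. rmixed [] (x *\<^sub>R e + (0 + (\<Sum>i\<in>set js. s i *\<^sub>R v i)))
       (x *\<^sub>R e - (0 + (\<Sum>i\<in>set js. s i *\<^sub>R v i))) > 0)"
  proof (rule rmixed_select_all[where \<tau> = \<tau>])
    show "v i \<in> rank_one_vecs" if "i \<in> set js" for i
      using v that js by (auto simp: rank_one_vecs_def)
  qed (use \<tau> S js pos in auto)
  then obtain s where s: "\<forall>i\<in>I. s i \<in> S i \<and> p i (s i) > 0"
    "\<And>x. x > 4 * \<sigma> \<Longrightarrow> rmixed [] (x *\<^sub>R e + (\<Sum>i\<in>I. s i *\<^sub>R v i)) (x *\<^sub>R e - (\<Sum>i\<in>I. s i *\<^sub>R v i)) > 0"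
    unfolding js(1) by auto
  define Y where "Y = (\<Sum>i\<in>I. s i *\<^sub>R v i)"
  have nz: "mpoly_eval h (x *\<^sub>R e + Y) \<noteq> 0 \<and> mpoly_eval h (x *\<^sub>R e - Y) \<noteq> 0" if "x > 4 * \<sigma>" for x
    using s(2)[OF that] by (auto simp: Y_def)
  have "(4 * \<sigma>) *\<^sub>R e - Y \<in> cone \<and> (4 * \<sigma>) *\<^sub>R e + Y \<in> cone"
    using nz[of "4 * \<sigma> + t" for t] by (auto simp: cone_def algebra_simps)
  then have "hyp_norm d h e Y \<le> 4 * \<sigma>" using hyp_norm_le_iff_cone[OF d, of "4 * \<sigma>" Y] \<sigma>(1) by simp
  then show ?thesis using that[of s] s(1) by (auto simp: Y_def)
qed

end

section \<open>Independent random variables with finite support\<close>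

lemma (in prob_space) expectation_finite_support:
  fixes X :: "'a \<Rightarrow> real"
  assumes X: "random_variable borel X" and S: "finite S" "AE \<omega> in M. X \<omega> \<in> S"
    and f: "f \<in> borel_measurable borel"
  shows "expectation (\<lambda>\<omega>. f (X \<omega>)) = (\<Sum>s\<in>S. prob (X -` {s} \<inter> space M) * (f s :: real))"
proof -
  note [measurable] = X f
  have sets: "X -` {s} \<inter> space M \<in> events" for s
    by (rule measurable_sets[OF X]) simp
  have "expectation (\<lambda>\<omega>. f (X \<omega>)) = expectation (\<lambda>\<omega>. \<Sum>s\<in>S. indicator (X -` {s} \<inter> space M) \<omega> *\<^sub>R f s)"
  proof (rule integral_cong_AE)
    show "AE \<omega> in M. f (X \<omega>) = (\<Sum>s\<in>S. indicator (X -` {s} \<inter> space M) \<omega> *\<^sub>R f s)"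
      using S(2) AE_space
    proof eventually_elim
      case (elim \<omega>)
      have "(\<Sum>s\<in>S. indicator (X -` {s} \<inter> space M) \<omega> *\<^sub>R f s) = (\<Sum>s\<in>S. if s = X \<omega> then f s else 0)"
        using elim by (intro sum.cong) (auto simp: indicator_def)
      then show ?case using elim S(1) by simp
    qed
    show "(\<lambda>\<omega>. \<Sum>s\<in>S. indicator (X -` {s} \<inter> space M) \<omega> *\<^sub>R f s) \<in> borel_measurable M"
      using sets by (intro borel_measurable_sum borel_measurable_scaleR borel_measurable_indicator) auto
  qed measurable
  also have "\<dots> = (\<Sum>s\<in>S. expectation (\<lambda>\<omega>. indicator (X -` {s} \<inter> space M) \<omega> *\<^sub>R f s))"
    using sets by (intro Bochner_Integration.integral_sum integrable_scaleR_left) (auto simp: emeasure_eq_measure)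
  also have "\<dots> = (\<Sum>s\<in>S. prob (X -` {s} \<inter> space M) * f s)"
    using sets by (intro sum.cong refl) (simp add: emeasure_eq_measure)
  finally show ?thesis .
qed

theorem theorem1p5:
  fixes d n :: nat
    and h :: "'m::finite mpoly"
    and e :: "real ^ 'm"
    and M :: "'a measure"
    and \<xi> :: "nat \<Rightarrow> 'a \<Rightarrow> real"
    and \<mu> \<tau> :: "nat \<Rightarrow> real"
    and v :: "nat \<Rightarrow> real ^ 'm"
    and \<sigma> :: real
  assumes "hyperbolic d h e"
    and "prob_space M"
    and "prob_space.indep_vars M (\<lambda>_. borel) \<xi> {1..n}"
    and "\<forall>i\<in>{1..n}. prob_space.finitely_supported M (\<xi> i)"
    and "\<forall>i\<in>{1..n}. prob_space.expectation M (\<xi> i) = \<mu> i"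
    and "\<forall>i\<in>{1..n}. prob_space.variance M (\<xi> i) = (\<tau> i)\<^sup>2"
    and "\<forall>i\<in>{1..n}. v i \<in> hyp_cone d h e"
    and "\<forall>i\<in>{1..n}. hyp_rank d h e (v i) \<le> 1"
    and "\<sigma> \<ge> 0"
    and "\<sigma>\<^sup>2 = hyp_norm d h e (\<Sum>i = 1..n. ((\<tau> i)\<^sup>2 * hyp_trace d h e (v i)) *\<^sub>R v i)"
  shows "prob_space.prob M
           {\<omega> \<in> space M. hyp_norm d h e (\<Sum>i = 1..n. (\<xi> i \<omega> - \<mu> i) *\<^sub>R v i) \<le> 4 * \<sigma>} > 0"
proof -
  interpret prob_space M by (rule assms(2))
  interpret hyperbolic_polynomial d h e by standard (rule assms(1))
  define E where "E = {\<omega> \<in> space M. hyp_norm d h e (\<Sum>i = 1..n. (\<xi> i \<omega> - \<mu> i) *\<^sub>R v i) \<le> 4 * \<sigma>}"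
  show ?thesis
  proof (cases "d = 0")
    case True
    \<comment> \<open>A constant \<open>h\<close> has no eigenvalues, and the norm is zero by convention.\<close>
    then have "E = space M" using assms(9) by (simp add: E_def hyp_norm_def)
    then have "prob E > 0" by (simp add: prob_space)
    then show ?thesis unfolding E_def .
  next
    case False
    then have d: "d > 0" by simp
    have rv: "random_variable borel (\<xi> i)" if "i \<in> {1..n}" for i
      using assms(3) that by (auto simp: indep_vars_def)
    have "\<forall>i\<in>{1..n}. \<exists>S. finite S \<and> (AE \<omega> in M. \<xi> i \<omega> \<in> S)"
      using assms(4) by (simp add: finitely_supported_def)
    then obtain S where S: "\<And>i. i \<in> {1..n} \<Longrightarrow> finite (S i) \<and> (AE \<omega> in M. \<xi> i \<omega> \<in> S i)" by metis
    define p where "p i s = prob (\<xi> i -` {\<mu> i + s} \<inter> space M)" for i s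
    define S' where "S' i = (\<lambda>s. s - \<mu> i) ` S i" for i
    have sum_S': "(\<Sum>s\<in>S' i. p i s * f s) = expectation (\<lambda>\<omega>. f (\<xi> i \<omega> - \<mu> i))"
      if i: "i \<in> {1..n}" and f: "f \<in> borel_measurable borel" for i and f :: "real \<Rightarrow> real"
    proof -
      note [measurable] = f
      have "expectation (\<lambda>\<omega>. f (\<xi> i \<omega> - \<mu> i)) = (\<Sum>s\<in>S i. prob (\<xi> i -` {s} \<inter> space M) * f (s - \<mu> i))"
        using S[OF i] rv[OF i] by (intro expectation_finite_support) auto
      also have "\<dots> = (\<Sum>s\<in>S' i. p i s * f s)"
        unfolding S'_def p_def by (subst sum.reindex) (auto simp: inj_on_def)
      finally show ?thesis by simp
    qed
    have int: "integrable M (\<xi> i)" if i: "i \<in> {1..n}" for i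
    proof -
      obtain B where "\<And>s. s \<in> S i \<Longrightarrow> \<bar>s\<bar> \<le> B"
        using S[OF i] by (metis finite_imp_bounded bounded_iff real_norm_def)
      then have "AE \<omega> in M. norm (\<xi> i \<omega>) \<le> B" using S[OF i] by auto
      then show ?thesis using rv[OF i] by (intro integrable_const_bound) auto
    qed
    obtain s where s: "\<And>i. i \<in> {1..n} \<Longrightarrow> s i \<in> S' i \<and> p i (s i) > 0"
      "hyp_norm d h e (\<Sum>i\<in>{1..n}. s i *\<^sub>R v i) \<le> 4 * \<sigma>"
    proof (rule exists_outcome_with_small_norm[of "{1..n}" "\<lambda>i. hyp_trace d h e (v i)" v "\<lambda>i. \<bar>\<tau> i\<bar>" S' p \<sigma>])
      show "rank_one (hyp_trace d h e (v i)) (v i)" if "i \<in> {1..n}" for i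
        using assms(7,8) that d by (intro rank_one_of_hyp_rank) auto
      show "finite (S' i)" if "i \<in> {1..n}" for i using S[OF that] by (simp add: S'_def)
      show "(\<Sum>s\<in>S' i. p i s) = 1" if "i \<in> {1..n}" for i
        using sum_S'[OF that, of "\<lambda>_. 1"] by (simp add: prob_space)
      show "(\<Sum>s\<in>S' i. p i s * s) = 0" if "i \<in> {1..n}" for i
        using sum_S'[OF that, of "\<lambda>s. s"] int[OF that] assms(5) that by (simp add: prob_space)
      show "(\<Sum>s\<in>S' i. p i s * s\<^sup>2) = \<bar>\<tau> i\<bar>\<^sup>2" if "i \<in> {1..n}" for i
        using sum_S'[OF that, of "\<lambda>s. s\<^sup>2"] assms(5,6) that by simp
      show "hyp_norm d h e (\<Sum>i\<in>{1..n}. (\<bar>\<tau> i\<bar>\<^sup>2 * hyp_trace d h e (v i)) *\<^sub>R v i) \<le> \<sigma>\<^sup>2"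
        using assms(10) by simp
    qed (use d assms(9) in \<open>auto simp: p_def\<close>)
    \<comment> \<open>The intersection over no indices would be all of the type instead of \<open>space M\<close>.\<close>
    define F where "F = (if n = 0 then space M else (\<Inter>i\<in>{1..n}. \<xi> i -` {\<mu> i + s i} \<inter> space M))"
    have "prob F > 0"
    proof (cases "n = 0")
      case False
      then have "prob F = (\<Prod>i\<in>{1..n}. prob (\<xi> i -` {\<mu> i + s i} \<inter> space M))"
        unfolding F_def using indep_varsD_finite[OF assms(3), of "\<lambda>i. {\<mu> i + s i}"] by simp
      then show ?thesis using s(1) by (auto simp: p_def intro!: prod_pos)
    qed (simp add: F_def prob_space)
    also have "prob F \<le> prob E"
    proof (rule finite_measure_mono)
      show "F \<subseteq> E"
      proof
        fix \<omega> assume \<omega>: "\<omega> \<in> F"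
        have "\<xi> i \<omega> - \<mu> i = s i" if "i \<in> {1..n}" for i
          using \<omega> that by (auto simp: F_def split: if_splits)
        then have "(\<Sum>i = 1..n. (\<xi> i \<omega> - \<mu> i) *\<^sub>R v i) = (\<Sum>i\<in>{1..n}. s i *\<^sub>R v i)"
          by (intro sum.cong) auto
        moreover have "\<omega> \<in> space M" using \<omega> by (auto simp: F_def split: if_splits)
        ultimately show "\<omega> \<in> E" using s(2) by (simp add: E_def)
      qed
      define Y where "Y \<omega> = (\<Sum>i = 1..n. (\<xi> i \<omega> - \<mu> i) *\<^sub>R v i)" for \<omega>
      have [measurable]: "Y \<in> borel_measurable M"
        unfolding Y_def using rv
        by (intro borel_measurable_sum borel_measurable_scaleR borel_measurable_diff) auto
      have [measurable]: "cone \<in> sets borel" by (rule borel_closed[OF closed_cone])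
      have "E = {\<omega> \<in> space M. (4 * \<sigma>) *\<^sub>R e - Y \<omega> \<in> cone \<and> (4 * \<sigma>) *\<^sub>R e + Y \<omega> \<in> cone}"
        unfolding E_def Y_def using hyp_norm_le_iff_cone[OF d, of "4 * \<sigma>"] assms(9) by simp
      also have "\<dots> \<in> events" by measurable
      finally show "E \<in> events" .
    qed
    finally show ?thesis unfolding E_def .
  qed
qed

end
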